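(* Let $K$ be the $2$-uniform tiling of the plane whose vertex types are $[3^2,4^1,3^1,4^1]$ and $[3^1,4^1,6^1,4^1]$. If $X$ is a map on the torus that is a quotient $X=K/\Gamma$ of $K$, then the vertices of $X$ form at most $6$ orbits under ${\rm Aut}(X)$.
   Context: A map is a polyhedral map: a cellular embedding of a connected graph in a closed surface such that the intersection of any two distinct faces is empty, a single vertex, or a single edge. For a vertex $u$, the faces containing $u$ form a cyclic sequence (the face-cycle at $u$); if this cyclic sequence consists of consecutive blocks of $n_1$ $p_1$-gons, then $n_2$ $p_2$-gons, ..., then $n_k$ $p_k$-gons, with cyclically consecutive $p_i$ distinct, then $u$ is said to have type $[p_1^{n_1},\dots,p_k^{n_k}]$ (defined up to cyclic shift and reversal). A $2$-uniform tiling is an edge-to-edge tiling of the Euclidean plane $\mathbb{R}^2$ by regular polygons whose symmetry group has exactly two orbits on the set of vertices; viewed as a map on the plane, its vertices have (at most) two types, listed as $[W;Z]$. (Up to isomorphism there are exactly $20$ such tilings; there is exactly one with the vertex types named in the claim.) For a map $K$ on the plane, a quotient of $K$ on the torus is a map $X$ on the torus together with a polyhedral covering map $\eta:K\to X$ with $X=K/\Gamma$, where $\Gamma\le {\rm Aut}(K)$ is a subgroup acting without fixed vertices, edges or faces and $K/\Gamma$ is homeomorphic to the torus. ${\rm Aut}(X)$ denotes the automorphism group of the map $X$, acting on its vertex set $V(X)$. *)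

theory Defs
  imports "HOL-Analysis.Analysis"
begin

text \<open>The tiling is realised geometrically in the Euclidean plane (identified with the
complex numbers), with edge length 1.  Points have coordinates of the form
((p + q sqrt 3)/2, (r + t sqrt 3)/2).  Faces are given as lists of vertices in cyclic
(counter-clockwise) order.  K consists of all translates, by the lattice spanned by
L1 = 2 + sqrt 3 and L2 = (2 + sqrt 3) e^(i pi/3), of the 15 prototile faces below
(one regular hexagon centred at 0, the six squares on its sides, the six triangles at its
corners, and two further triangles).\<close>

definition pt :: "int \<Rightarrow> int \<Rightarrow> int \<Rightarrow> int \<Rightarrow> complex" where
  "pt p q r t = Complex ((of_int p + of_int q * sqrt 3) / 2) ((of_int r + of_int t * sqrt 3) / 2)"

definition K_L1 :: complex where "K_L1 = pt 4 2 0 0"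
definition K_L2 :: complex where "K_L2 = pt 2 1 3 2"

definition K_protos :: "complex list list" where
  "K_protos = [
    [pt (2) (0) (0) (0), pt (1) (0) (0) (1), pt (-1) (0) (0) (1), pt (-2) (0) (0) (0), pt (-1) (0) (0) (-1), pt (1) (0) (0) (-1)],
    [pt (1) (0) (0) (1), pt (2) (0) (0) (0), pt (2) (1) (1) (0), pt (1) (1) (1) (1)],
    [pt (-1) (0) (0) (1), pt (1) (0) (0) (1), pt (1) (0) (2) (1), pt (-1) (0) (2) (1)],
    [pt (-2) (0) (0) (0), pt (-1) (0) (0) (1), pt (-1) (-1) (1) (1), pt (-2) (-1) (1) (0)],
    [pt (-1) (0) (0) (-1), pt (-2) (0) (0) (0), pt (-2) (-1) (-1) (0), pt (-1) (-1) (-1) (-1)],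
    [pt (1) (0) (0) (-1), pt (-1) (0) (0) (-1), pt (-1) (0) (-2) (-1), pt (1) (0) (-2) (-1)],
    [pt (2) (0) (0) (0), pt (1) (0) (0) (-1), pt (1) (1) (-1) (-1), pt (2) (1) (-1) (0)],
    [pt (2) (0) (0) (0), pt (2) (1) (-1) (0), pt (2) (1) (1) (0)],
    [pt (1) (0) (0) (1), pt (1) (1) (1) (1), pt (1) (0) (2) (1)],
    [pt (-1) (0) (0) (1), pt (-1) (0) (2) (1), pt (-1) (-1) (1) (1)],
    [pt (-2) (0) (0) (0), pt (-2) (-1) (1) (0), pt (-2) (-1) (-1) (0)],
    [pt (-1) (0) (0) (-1), pt (-1) (-1) (-1) (-1), pt (-1) (0) (-2) (-1)],
    [pt (1) (0) (0) (-1), pt (1) (0) (-2) (-1), pt (1) (1) (-1) (-1)],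
    [pt (2) (1) (1) (0), pt (3) (1) (1) (1), pt (1) (1) (1) (1)],
    [pt (2) (1) (-1) (0), pt (1) (1) (-1) (-1), pt (3) (1) (-1) (-1)]]"

definition K_face_lists :: "complex list set" where
  "K_face_lists = {map (\<lambda>z. z + of_int m * K_L1 + of_int n * K_L2) P
                    | P m n. P \<in> set K_protos}"

text \<open>Faces of K as vertex sets (for a polyhedral map a face is determined by its vertex set).\<close>
definition K_faces :: "complex set set" where
  "K_faces = set ` K_face_lists"

definition K_vertices :: "complex set" where
  "K_vertices = \<Union> K_faces"

definition cyc_edges :: "'a list \<Rightarrow> 'a set set" where
  "cyc_edges P = {{P ! i, P ! (Suc i mod length P)} | i. i < length P}"

definition K_edges :: "complex set set" where
  "K_edges = \<Union> (cyc_edges ` K_face_lists)"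

text \<open>A (map) automorphism of K, realised topologically: a homeomorphism of the plane
(the surface carrying K) mapping vertices onto vertices, edges onto edges and each closed
face (the convex polygon spanned by its vertices) onto a closed face.\<close>
definition K_aut :: "(complex \<Rightarrow> complex) \<Rightarrow> bool" where
  "K_aut g \<longleftrightarrow>
     (\<exists>h. homeomorphism UNIV UNIV g h) \<and>
     g ` K_vertices = K_vertices \<and>
     (\<forall>E\<in>K_edges. g ` E \<in> K_edges) \<and>
     (\<forall>F\<in>K_faces. g ` F \<in> K_faces \<and> g ` (convex hull F) = convex hull (g ` F))"

definition K_aut_subgroup :: "(complex \<Rightarrow> complex) set \<Rightarrow> bool" where
  "K_aut_subgroup \<Gamma> \<longleftrightarrow>
     (\<forall>g\<in>\<Gamma>. K_aut g) \<and> id \<in> \<Gamma> \<and>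
     (\<forall>g\<in>\<Gamma>. \<forall>h\<in>\<Gamma>. g \<circ> h \<in> \<Gamma>) \<and> (\<forall>g\<in>\<Gamma>. inv g \<in> \<Gamma>)"

definition acts_freely :: "(complex \<Rightarrow> complex) set \<Rightarrow> bool" where
  "acts_freely \<Gamma> \<longleftrightarrow>
     (\<forall>g\<in>\<Gamma>. g \<noteq> id \<longrightarrow>
        (\<forall>v\<in>K_vertices. g v \<noteq> v) \<and> (\<forall>E\<in>K_edges. g ` E \<noteq> E) \<and> (\<forall>F\<in>K_faces. g ` F \<noteq> F))"

definition torus_top :: "(complex \<times> complex) topology" where
  "torus_top = prod_topology (top_of_set (sphere 0 1)) (top_of_set (sphere 0 1))"

text \<open>The orbit space R^2/Gamma (of the surface of K) is homeomorphic to the torus: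
there is a quotient map from the plane onto the torus whose fibres are exactly the
Gamma-orbits.\<close>
definition quotient_is_torus :: "(complex \<Rightarrow> complex) set \<Rightarrow> bool" where
  "quotient_is_torus \<Gamma> \<longleftrightarrow>
     (\<exists>q :: complex \<Rightarrow> complex \<times> complex.
        quotient_map euclidean torus_top q \<and> (\<forall>x y. q x = q y \<longleftrightarrow> (\<exists>g\<in>\<Gamma>. g x = y)))"

definition orb :: "(complex \<Rightarrow> complex) set \<Rightarrow> complex \<Rightarrow> complex set" where
  "orb \<Gamma> v = (\<lambda>g. g v) ` \<Gamma>"

definition X_vertices :: "(complex \<Rightarrow> complex) set \<Rightarrow> complex set set" where
  "X_vertices \<Gamma> = orb \<Gamma> ` K_vertices"

definition X_faces :: "(complex \<Rightarrow> complex) set \<Rightarrow> complex set set set" where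
  "X_faces \<Gamma> = (\<lambda>F. orb \<Gamma> ` F) ` K_faces"

definition X_edges :: "(complex \<Rightarrow> complex) set \<Rightarrow> complex set set set" where
  "X_edges \<Gamma> = (\<lambda>E. orb \<Gamma> ` E) ` K_edges"

text \<open>X = K/Gamma is a polyhedral map and eta : K -> X a polyhedral covering: every face of
K is mapped bijectively onto its image (so faces of X are genuine polygons), and two distinct
faces of X meet in nothing, a single vertex, or a single edge which is an edge of both.\<close>
definition X_polyhedral :: "(complex \<Rightarrow> complex) set \<Rightarrow> bool" where
  "X_polyhedral \<Gamma> \<longleftrightarrow>
     (\<forall>P\<in>K_face_lists. inj_on (orb \<Gamma>) (set P)) \<and>
     (\<forall>P\<in>K_face_lists. \<forall>Q\<in>K_face_lists.
        let A = orb \<Gamma> ` set P; B = orb \<Gamma> ` set Q in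
        A \<noteq> B \<longrightarrow>
          (A \<inter> B = {} \<or> card (A \<inter> B) = 1 \<or>
           ((\<exists>E\<in>cyc_edges P. orb \<Gamma> ` E = A \<inter> B) \<and> (\<exists>E\<in>cyc_edges Q. orb \<Gamma> ` E = A \<inter> B))))"

definition X_aut :: "(complex \<Rightarrow> complex) set \<Rightarrow> (complex set \<Rightarrow> complex set) set" where
  "X_aut \<Gamma> = {\<sigma>. bij_betw \<sigma> (X_vertices \<Gamma>) (X_vertices \<Gamma>) \<and>
                  (\<lambda>E. \<sigma> ` E) ` X_edges \<Gamma> = X_edges \<Gamma> \<and>
                  (\<lambda>A. \<sigma> ` A) ` X_faces \<Gamma> = X_faces \<Gamma>}"

definition X_aut_vertex_orbits :: "(complex \<Rightarrow> complex) set \<Rightarrow> complex set set set" where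
  "X_aut_vertex_orbits \<Gamma> = (\<lambda>x. (\<lambda>\<sigma>. \<sigma> x) ` X_aut \<Gamma>) ` X_vertices \<Gamma>"

end

theory Submission
  imports Defs
begin

text \<open>A combinatorial automorphism of the tiling is determined by its values on one hexagon, so on
  vertices it agrees with a symmetry z \<mapsto> u z + l or z \<mapsto> u cnj z + l, where u is a sixth root
  of unity and l a lattice vector. In a group acting freely on the cells no element agrees with a
  nontrivial rotation, since rotations fix a cell. The action is then free and properly
  discontinuous on the whole plane, so the plane covers the torus and the group, being the deck
  group, is abelian. A glide reflection in an abelian group would bound the distance to its axis
  on a cocompact orbit, so the group consists of translations. Hence all lattice translations and
  the half-turn about a hexagon centre descend to the quotient; on the 12 lattice classes
  of vertices the half-turn has 6 orbits.\<close>

subsection \<open>Coverings of the torus\<close>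

text \<open>Elements of \<open>\<Gamma>\<close> are merely homeomorphisms permuting closed cells: an
  affine formula is available on vertices only, and freeness is assumed on cells only. The inside of
  a tile is controlled by a coarse estimate instead. Every point lies in the hull of a face, face
  hulls have bounded diameter and go to face hulls, so up to a constant each element moves all
  points like its isometry on vertices. Hence few elements bring a bounded set back, point
  stabilisers are finite, and absence of torsion makes them trivial. Freeness on cells still permits
  glide reflections, as for Klein bottle quotients; the torus must therefore enter, and it does so
  through commutativity and compactness of the quotient. The half-turn always descends because
  conjugation by -1 inverts every translation, so it normalises any group of translations. A
  rotation by 60 degrees need not preserve a sublattice. The bound 6 is half of 12: modulo the
  lattice there are six hexagon corners and six outer corners of squares, and -1 pairs them
  off.\<close>

lemma orbit_map_covering_space:
  fixes q :: "'a::t2_space \<Rightarrow> 'b::topological_space"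
  assumes q: "quotient_map euclidean (top_of_set S) q"
    and fib: "\<And>x y. q x = q y \<longleftrightarrow> (\<exists>g\<in>\<Gamma>. g x = y)"
    and hom: "\<And>g. g \<in> \<Gamma> \<Longrightarrow> \<exists>h. homeomorphism UNIV UNIV g h"
    and comp: "\<And>g h. g \<in> \<Gamma> \<Longrightarrow> h \<in> \<Gamma> \<Longrightarrow> g \<circ> h \<in> \<Gamma>"
    and inver: "\<And>g. g \<in> \<Gamma> \<Longrightarrow> inv g \<in> \<Gamma>"
    and disc: "\<And>x. \<exists>U. open U \<and> x \<in> U \<and> (\<forall>g\<in>\<Gamma>. g ` U \<inter> U \<noteq> {} \<longrightarrow> g = id)"
  shows "covering_space UNIV q S"
    and "\<And>U. open U \<Longrightarrow> openin (top_of_set S) (q ` U)"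
proof -
  have im: "q ` UNIV = S"
    using quotient_imp_surjective_map[OF q] by simp
  have cont: "continuous_on UNIV q"
    using quotient_imp_continuous_map[OF q] by (simp add: continuous_map_in_subtopology)
  have bij: "bij g" if "g \<in> \<Gamma>" for g
    using hom[OF that] by (metis homeomorphism_def bij_betw_def inj_on_inverseI)
  have opn: "open (g ` U)" if "g \<in> \<Gamma>" "open U" for g U
    using hom[OF that(1)] homeomorphism_imp_open_map[of UNIV UNIV g _ U] that(2) by auto
  have pre: "q -` (q ` U) = (\<Union>g\<in>\<Gamma>. g ` U)" for U
    using fib by (auto simp: image_iff) (metis+)
  show oq: "openin (top_of_set S) (q ` U)" if "open U" for U
  proof -
    have "open (q -` (q ` U))"
      unfolding pre using opn that by auto
    moreover have "q ` U \<subseteq> S" using im by blast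
    ultimately show ?thesis
      using q by (simp add: quotient_map_def vimage_def)
  qed
  show "covering_space UNIV q S"
    unfolding covering_space_def
  proof (intro conjI ballI cont im)
    fix y assume "y \<in> S"
    then obtain x where x: "q x = y" using im by auto
    obtain U where U: "open U" "x \<in> U" "\<And>g. g \<in> \<Gamma> \<Longrightarrow> g ` U \<inter> U \<noteq> {} \<Longrightarrow> g = id"
      using disc by metis
    have dis: "g = h" if gh: "g \<in> \<Gamma>" "h \<in> \<Gamma>" "g ` U \<inter> h ` U \<noteq> {}" for g h
    proof -
      obtain u v where uv: "u \<in> U" "v \<in> U" "g u = h v" using gh(3) by auto
      have "(inv h \<circ> g) u = v" using uv bij[OF gh(2)] by (simp add: bij_def)
      then have "inv h \<circ> g = id" using U(3)[of "inv h \<circ> g"] comp inver gh uv by blast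
      then show ?thesis
        by (metis bij bij_is_surj comp_id fun.map_comp gh(2) id_comp surj_iff)
    qed
    have homeo: "\<exists>p. homeomorphism u (q ` U) q p" if u: "u \<in> (\<lambda>g. g ` U) ` \<Gamma>" for u
    proof -
      obtain g where g: "g \<in> \<Gamma>" "u = g ` U" using u by auto
      have ou: "open u" using g opn U by auto
      have qu: "q ` u = q ` U"
      proof -
        have "q (g z) = q z" for z using fib g(1) by metis
        then show ?thesis using g(2) by (simp add: image_image)
      qed
      have inj: "inj_on q u"
      proof (rule inj_onI)
        fix a b assume ab: "a \<in> u" "b \<in> u" "q a = q b"
        then obtain k where k: "k \<in> \<Gamma>" "k a = b" using fib by metis
        have "(k \<circ> g) ` U \<inter> g ` U \<noteq> {}" using ab k g by (auto simp: image_iff)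
        then have "k \<circ> g = g" using dis comp k g by blast
        then show "a = b" using ab k g by (auto simp: fun_eq_iff)
      qed
      have "\<exists>p. homeomorphism u (q ` u) q p"
      proof (rule homeomorphism_injective_open_map[OF _ refl inj])
        show "continuous_on u q" using cont continuous_on_subset by blast
        show "openin (top_of_set (q ` u)) (q ` T)" if "openin (top_of_set u) T" for T
        proof -
          have T: "open T" "T \<subseteq> u" using that ou openin_open_eq by auto
          from oq[OF T(1)] show ?thesis
            by (rule openin_subset_trans) (use T im in auto)
        qed
      qed auto
      then show ?thesis using qu by simp
    qed
    have y: "y \<in> q ` U" using U x by blast
    show "\<exists>T. y \<in> T \<and> openin (top_of_set S) T \<and>
              (\<exists>v. \<Union> v = UNIV \<inter> q -` T \<and> (\<forall>u\<in>v. openin (top_of_set UNIV) u) \<and>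
                   pairwise disjnt v \<and> (\<forall>u\<in>v. \<exists>p. homeomorphism u T q p))"
      apply (rule exI[of _ "q ` U"])
      apply (intro conjI y oq U(1) exI[of _ "(\<lambda>g. g ` U) ` \<Gamma>"])
      subgoal by (simp add: pre)
      subgoal using opn U(1) by auto
      subgoal using dis by (auto simp: pairwise_def disjnt_def)
      subgoal using homeo by blast
      done
  qed
qed

text \<open>The plane is contractible, so f has a continuous logarithm; modulus one forces its real
  part to vanish, and the imaginary part is the angle.\<close>

lemma circle_valued_lift:
  fixes f :: "complex \<Rightarrow> complex"
  assumes "continuous_on UNIV f" "\<And>z. f z \<in> sphere 0 1"
  obtains \<theta> :: "complex \<Rightarrow> real" where "continuous_on UNIV \<theta>" "\<And>z. f z = cis (\<theta> z)"
proof -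
  have "f z \<noteq> 0" for z using assms(2)[of z] by auto
  then obtain g where g: "continuous_on UNIV g" "\<And>z. f z = exp (g z)"
    using continuous_logarithm_on_contractible[OF assms(1)] contractible_UNIV by auto
  have "f z = cis (Im (g z))" for z
  proof -
    have "exp (Re (g z)) = 1" using assms(2)[of z] g(2)[of z] by (simp add: norm_exp_eq_Re)
    then show ?thesis using g(2)[of z] by (simp add: exp_eq_polar)
  qed
  then show ?thesis using that[of "\<lambda>z. Im (g z)"] g(1) by (auto intro: continuous_intros)
qed

text \<open>The difference divided by 2 pi is continuous and integer-valued, hence constant on a
  connected space. Applied to an angle function and its composition with a deck transformation, this
  shows that the latter acts on angles by a shift.\<close>

lemma cis_diff_constant:
  fixes a b :: "'a::real_normed_vector \<Rightarrow> real"
  assumes "continuous_on UNIV a" "continuous_on UNIV b" "\<And>z. cis (a z) = cis (b z)"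
  shows "\<exists>c. \<forall>z. a z = b z + c"
proof -
  let ?d = "\<lambda>z. (a z - b z) / (2*pi)"
  have int: "?d z \<in> \<int>" for z
  proof -
    have "cis (a z - b z) = 1" using assms(3)[of z] by (simp flip: cis_divide)
    then obtain n :: int where "a z - b z = 2 * pi * n"
      by (metis cis.sel(1) cos_one_2pi_int one_complex.sel(1) mult.commute mult.assoc)
    then show ?thesis by simp
  qed
  have "?d constant_on UNIV"
  proof (rule continuous_discrete_range_constant[OF connected_UNIV])
    show "continuous_on UNIV ?d" using assms by (intro continuous_intros) auto
    show "\<exists>e>0. \<forall>y. y \<in> UNIV \<and> ?d y \<noteq> ?d x \<longrightarrow> e \<le> norm (?d y - ?d x)" for x
    proof (intro exI[of _ 1] conjI allI impI)
      fix y assume y: "y \<in> UNIV \<and> ?d y \<noteq> ?d x"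
      have "?d y - ?d x \<in> \<int>" "?d y - ?d x \<noteq> 0" using int y by auto
      then show "1 \<le> norm (?d y - ?d x)"
        using Ints_nonzero_abs_ge1 by (metis real_norm_def)
    qed auto
  qed
  then obtain c where c: "\<And>z. ?d z = c" by (auto simp: constant_on_def)
  show ?thesis
  proof (intro exI[of _ "2*pi*c"] allI)
    fix z show "a z = b z + 2*pi*c" using c[of z] by (simp add: field_simps)
  qed
qed

text \<open>The deck group is the fundamental group of the torus. Instead of developing fundamental
  groups, lift q to the universal cover of the torus: the lift is injective and turns the deck
  transformations into translations.\<close>
lemma torus_deck_commute:
  fixes q :: "complex \<Rightarrow> complex \<times> complex"
  assumes cov: "covering_space UNIV q (sphere 0 1 \<times> sphere 0 1)"
    and fib: "\<And>x y. q x = q y \<longleftrightarrow> (\<exists>g\<in>\<Gamma>. g x = y)"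
    and cont: "\<And>g. g \<in> \<Gamma> \<Longrightarrow> continuous_on UNIV g"
    and inj: "\<And>g. g \<in> \<Gamma> \<Longrightarrow> inj g"
    and gh: "g \<in> \<Gamma>" "h \<in> \<Gamma>"
  shows "g \<circ> h = h \<circ> g"
proof -
  have contq: "continuous_on UNIV q" and imq: "q ` UNIV = sphere 0 1 \<times> sphere 0 1"
    using cov by (auto simp: covering_space_def)
  have q12: "fst (q z) \<in> sphere 0 1" "snd (q z) \<in> sphere 0 1" for z
    using imq by (metis mem_Times_iff rangeI)+
  obtain a where a: "continuous_on UNIV a" "\<And>z. fst (q z) = cis (a z)"
    using circle_valued_lift[of "\<lambda>z. fst (q z)"] q12 contq continuous_on_fst by blast
  obtain b where b: "continuous_on UNIV b" "\<And>z. snd (q z) = cis (b z)"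
    using circle_valued_lift[of "\<lambda>z. snd (q z)"] q12 contq continuous_on_snd by blast
  define e :: "real \<times> real \<Rightarrow> complex \<times> complex" where "e = (\<lambda>p. (cis (fst p), cis (snd p)))"
  have conte: "continuous_on UNIV e"
    unfolding e_def cis_conv_exp by (intro continuous_intros)
  \<comment> \<open>\<open>e\<close> is the universal covering of the torus by the plane of angles,
    which is simply connected, so \<open>e\<close> lifts through the covering
    \<open>q\<close>.\<close>
  obtain E where E: "continuous_on UNIV E" "\<And>p. q (E p) = e p"
    using covering_space_lift[OF cov _ _ conte]
    by (auto simp: e_def convex_imp_simply_connected convex_imp_locally_path_connected Pi_iff)
  define \<theta> where "\<theta> = (\<lambda>z. (a z, b z))"
  have cont\<theta>: "continuous_on UNIV \<theta>"
    unfolding \<theta>_def using a b by (intro continuous_intros)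
  have q\<theta>: "e (\<theta> z) = q z" for z
    using a(2)[of z] b(2)[of z] by (simp add: \<theta>_def e_def prod_eq_iff)
  \<comment> \<open>\<open>E\<close> after \<open>\<theta>\<close> lifts \<open>q\<close> through
    \<open>q\<close> itself, and so does every element of the group. Choosing k to agree at 0,
    uniqueness of lifts makes the two equal, and injectivity of k passes to
    \<open>\<theta>\<close>.\<close>
  obtain k where k: "k \<in> \<Gamma>" "k 0 = E (\<theta> 0)"
    using fib E(2) q\<theta> by metis
  have qk: "q (k z) = q z" for z using fib k(1) by metis
  have qS: "q \<in> UNIV \<rightarrow> sphere 0 1 \<times> sphere 0 1" using imq by blast
  have contE\<theta>: "continuous_on UNIV (\<lambda>z. E (\<theta> z))"
    using continuous_on_compose2[OF E(1) cont\<theta>] by auto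
  have "k z = E (\<theta> z)" for z
    by (rule covering_space_lift_unique[of _ _ _ k 0 "\<lambda>z. E (\<theta> z)" UNIV q z, OF cov k(2) contq qS cont[OF k(1)] _ _ contE\<theta>])
      (auto simp: qk E(2) q\<theta>)
  then have inj\<theta>: "inj \<theta>"
    using inj[OF k(1)] by (metis injD injI)
  have tr: "\<exists>c. \<forall>z. \<theta> (f z) = \<theta> z + c" if f: "f \<in> \<Gamma>" for f
  proof -
    have qf: "q (f z) = q z" for z using fib f by metis
    have af: "continuous_on UNIV (\<lambda>z. a (f z))" and bf: "continuous_on UNIV (\<lambda>z. b (f z))"
      using continuous_on_compose2[OF a(1) cont[OF f]] continuous_on_compose2[OF b(1) cont[OF f]] by auto
    obtain c where c: "\<And>z. a (f z) = a z + c"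
      using cis_diff_constant[OF af a(1)] qf a(2) by metis
    obtain d where d: "\<And>z. b (f z) = b z + d"
      using cis_diff_constant[OF bf b(1)] qf b(2) by metis
    show ?thesis by (intro exI[of _ "(c,d)"]) (simp add: \<theta>_def c d)
  qed
  obtain c d where "\<And>z. \<theta> (g z) = \<theta> z + c" "\<And>z. \<theta> (h z) = \<theta> z + d"
    using tr[OF gh(1)] tr[OF gh(2)] by metis
  then have "\<theta> (g (h z)) = \<theta> (h (g z))" for z by (simp add: algebra_simps)
  then show ?thesis using injD[OF inj\<theta>] by (intro ext) simp
qed


text \<open>The multiplicity of 3 is even in a square and odd in three times a square.\<close>

lemma sqrt3_independent:
  assumes "of_int x + of_int y * sqrt 3 = 0"
  shows "x = 0 \<and> y = 0"
proof -
  have eq: "x^2 = 3 * y^2"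
  proof -
    have "(of_int x :: real)^2 = (of_int y * sqrt 3)^2"
      using assms by (metis add_eq_0_iff2 power2_minus)
    then have "(of_int (x^2) :: real) = of_int (3 * y^2)" by (simp add: power_mult_distrib)
    then show ?thesis by (simp only: of_int_eq_iff)
  qed
  have "y = 0"
  proof (rule ccontr)
    assume "y \<noteq> 0"
    then have "x \<noteq> 0" using eq by auto
    have p: "prime (3::int)" by simp
    have "multiplicity 3 (x^2) = multiplicity 3 (3 * y^2)" using eq by simp
    then have "2 * multiplicity 3 x = Suc (2 * multiplicity 3 y)"
      using p \<open>x \<noteq> 0\<close> \<open>y \<noteq> 0\<close>
      by (simp add: prime_elem_multiplicity_power_distrib prime_elem_multiplicity_mult_distrib prime_imp_prime_elem)
    then show False by presburger
  qed
  then show ?thesis using eq by simp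
qed

subsection \<open>Integer coordinates\<close>

definition \<omega> :: complex where "\<omega> = Complex (1/2) (sqrt 3 / 2)"

text \<open>Coordinates in the ring of integers of the 12th cyclotomic field. Rotation by 60 degrees and
  conjugation act integrally on them, so incidences of cells become linear integer arithmetic.\<close>
definition W :: "int \<Rightarrow> int \<Rightarrow> int \<Rightarrow> int \<Rightarrow> complex" where
  "W a b c d = (of_int a + of_int b * \<omega>) + \<i> * (of_int c + of_int d * \<omega>)"

text \<open>The product of 2 + sqrt 3 and m + n \<open>\<omega>\<close>, expanded with sqrt 3 =
  \<open>\<i> * (1 - 2 * \<omega>)\<close>.\<close>

definition lat :: "int \<Rightarrow> int \<Rightarrow> complex" where
  "lat m n = W (2*m) (2*n) (m + 2*n) (- 2*m - n)"

lemma W_add: "W a b c d + W a' b' c' d' = W (a+a') (b+b') (c+c') (d+d')"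
  and W_minus: "- W a b c d = W (-a) (-b) (-c) (-d)"
  and W_diff: "W a b c d - W a' b' c' d' = W (a-a') (b-b') (c-c') (d-d')"
  by (simp_all add: W_def algebra_simps)

lemma W_Re: "Re (W a b c d) = (of_int (2*a+b) + of_int (-d) * sqrt 3) / 2"
  and W_Im: "Im (W a b c d) = (of_int (2*c+d) + of_int b * sqrt 3) / 2"
  by (simp_all add: W_def \<omega>_def field_simps)

lemma W_eq_iff [simp]: "W a b c d = W a' b' c' d' \<longleftrightarrow> a = a' \<and> b = b' \<and> c = c' \<and> d = d'"
proof
  assume eq: "W a b c d = W a' b' c' d'"
  have 1: "of_int (2*(a-a')+(b-b')) + of_int (d'-d) * sqrt 3 = 0"
    using arg_cong[OF eq, of Re] unfolding W_Re by (simp add: field_simps)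
  have 2: "of_int (2*(c-c')+(d-d')) + of_int (b-b') * sqrt 3 = 0"
    using arg_cong[OF eq, of Im] unfolding W_Im by (simp add: field_simps)
  show "a = a' \<and> b = b' \<and> c = c' \<and> d = d'"
    using sqrt3_independent[OF 1] sqrt3_independent[OF 2] by auto
qed auto

lemma omega_sq: "\<omega> * \<omega> = \<omega> - 1"
  and omega_cnj: "cnj \<omega> = 1 - \<omega>"
  and omega_mult_cnj: "\<omega> * cnj \<omega> = 1"
  by (simp_all add: \<omega>_def complex_eq_iff)

lemma omega_power3: "\<omega> ^ 3 = -1"
proof -
  have "\<omega> ^ 3 = \<omega> * (\<omega> * \<omega>)" by (simp add: power3_eq_cube)
  also have "\<dots> = \<omega> * \<omega> - \<omega>" unfolding omega_sq by (simp add: right_diff_distrib omega_sq)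
  finally show ?thesis by (simp add: omega_sq)
qed

lemma omega_power6: "\<omega> ^ 6 = 1"
proof -
  have "\<omega>^6 = (\<omega>^3)^2" by (simp flip: power_mult)
  then show ?thesis by (simp add: omega_power3)
qed

lemma norm_omega: "cmod \<omega> = 1"
  by (simp add: \<omega>_def cmod_def power2_eq_square)

lemma W_rot: "\<omega> * W a b c d = W (-b) (a+b) (-d) (c+d)"
proof -
  have "\<omega> * W a b c d = of_int a * \<omega> + of_int b * (\<omega> * \<omega>) + \<i> * (of_int c * \<omega> + of_int d * (\<omega> * \<omega>))"
    by (simp add: W_def algebra_simps)
  then show ?thesis unfolding omega_sq by (simp add: W_def algebra_simps)
qed

lemma W_cnj: "cnj (W a b c d) = W (a+b) (-b) (-c-d) d"
  by (simp add: W_def omega_cnj algebra_simps)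

lemma pt_W: "p = 2*a + b \<Longrightarrow> q = -d \<Longrightarrow> r = 2*c + d \<Longrightarrow> t = b \<Longrightarrow> pt p q r t = W a b c d"
  by (simp add: complex_eq_iff W_Re W_Im pt_def)

lemma lat_eq: "lat m n = of_int m * K_L1 + of_int n * K_L2"
proof -
  have 1: "K_L1 = W 2 0 1 (-2)" and 2: "K_L2 = W 0 2 2 (-1)"
    unfolding K_L1_def K_L2_def by (rule pt_W; simp)+
  show ?thesis unfolding lat_def 1 2 by (simp add: W_def algebra_simps)
qed

lemma lat_0 [simp]: "lat 0 0 = 0"
  and lat_add: "lat m n + lat m' n' = lat (m+m') (n+n')"
  and lat_minus: "- lat m n = lat (-m) (-n)"
  and lat_rot: "\<omega> * lat m n = lat (-n) (m+n)"
  and lat_cnj: "cnj (lat m n) = lat (m+n) (-n)"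
  by (simp_all add: lat_def W_add W_minus W_rot W_cnj algebra_simps) (simp add: W_def)

lemma W_plus_lat: "W a b c d + lat m n = W (a+2*m) (b+2*n) (c+m+2*n) (d-2*m-n)"
  by (simp add: lat_def W_add algebra_simps)

lemma lat_eq_iff [simp]: "lat m n = lat m' n' \<longleftrightarrow> m = m' \<and> n = n'"
  by (auto simp: lat_def)

lemma lat_power_rot: "\<exists>m' n'. \<omega>^k * lat m n = lat m' n'"
proof (induction k)
  case (Suc k)
  then show ?case by (metis lat_rot mult.assoc power_Suc)
qed auto

text \<open>Later arguments name tiles by index: 0 is the hexagon, 1 to 6 the squares and 7 to 12
  the corner triangles, each in counter-clockwise order, and 13 and 14 are the two further
  triangles.\<close>

definition protos :: "complex list list" where
  "protos = [
    [W 1 0 0 0, W 0 1 0 0, W (-1) 1 0 0, W (-1) 0 0 0, W 0 (-1) 0 0, W 1 (-1) 0 0],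
    [W 0 1 0 0, W 1 0 0 0, W 1 0 1 (-1), W 0 1 1 (-1)],
    [W (-1) 1 0 0, W 0 1 0 0, W 0 1 1 0, W (-1) 1 1 0],
    [W (-1) 0 0 0, W (-1) 1 0 0, W (-1) 1 0 1, W (-1) 0 0 1],
    [W 0 (-1) 0 0, W (-1) 0 0 0, W (-1) 0 (-1) 1, W 0 (-1) (-1) 1],
    [W 1 (-1) 0 0, W 0 (-1) 0 0, W 0 (-1) (-1) 0, W 1 (-1) (-1) 0],
    [W 1 0 0 0, W 1 (-1) 0 0, W 1 (-1) 0 (-1), W 1 0 0 (-1)],
    [W 1 0 0 0, W 1 0 0 (-1), W 1 0 1 (-1)],
    [W 0 1 0 0, W 0 1 1 (-1), W 0 1 1 0],
    [W (-1) 1 0 0, W (-1) 1 1 0, W (-1) 1 0 1],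
    [W (-1) 0 0 0, W (-1) 0 0 1, W (-1) 0 (-1) 1],
    [W 0 (-1) 0 0, W 0 (-1) (-1) 1, W 0 (-1) (-1) 0],
    [W 1 (-1) 0 0, W 1 (-1) (-1) 0, W 1 (-1) 0 (-1)],
    [W 1 0 1 (-1), W 1 1 1 (-1), W 0 1 1 (-1)],
    [W 1 0 0 (-1), W 1 (-1) 0 (-1), W 2 (-1) 0 (-1)]]"

lemma K_protos_eq: "K_protos = protos"
  unfolding K_protos_def protos_def
  by (intro arg_cong2[of _ _ _ _ Cons] refl; rule pt_W; simp)

lemma K_face_lists_iff:
  "Q \<in> K_face_lists \<longleftrightarrow> (\<exists>P\<in>set protos. \<exists>m n. Q = map (\<lambda>z. z + lat m n) P)"
  unfolding K_face_lists_def K_protos_eq lat_eq add.assoc by blast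

lemma K_faces_iff:
  "F \<in> K_faces \<longleftrightarrow> (\<exists>P\<in>set protos. \<exists>m n. F = (\<lambda>z. z + lat m n) ` set P)"
proof
  assume "F \<in> K_faces"
  then obtain Q where "Q \<in> K_face_lists" "F = set Q" unfolding K_faces_def by blast
  then show "\<exists>P\<in>set protos. \<exists>m n. F = (\<lambda>z. z + lat m n) ` set P"
    unfolding K_face_lists_iff by (metis list.set_map)
next
  assume "\<exists>P\<in>set protos. \<exists>m n. F = (\<lambda>z. z + lat m n) ` set P"
  then obtain P m n where P: "P \<in> set protos" "F = (\<lambda>z. z + lat m n) ` set P" by blast
  then have "map (\<lambda>z. z + lat m n) P \<in> K_face_lists" unfolding K_face_lists_iff by blast
  moreover have "F = set (map (\<lambda>z. z + lat m n) P)" using P(2) by simp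
  ultimately show "F \<in> K_faces" unfolding K_faces_def by (rule rev_image_eqI)
qed

lemma cyc_edges_conv: "cyc_edges P = set (map (\<lambda>i. {P ! i, P ! (Suc i mod length P)}) [0..<length P])"
  unfolding cyc_edges_def by auto

lemma cyc_edges_map: "cyc_edges (map f P) = image f ` cyc_edges P"
proof -
  have "{map f P ! i, map f P ! (Suc i mod length P)} = f ` {P ! i, P ! (Suc i mod length P)}"
    if "i < length P" for i
    using that by (simp add: nth_map mod_less_divisor[OF order.strict_trans1[OF le0]])
  then show ?thesis unfolding cyc_edges_conv set_map image_image by (auto simp: image_def)
qed

lemma cyc_edges_3: "cyc_edges [a,b,c] = {{a,b},{b,c},{c,a}}"
  and cyc_edges_4: "cyc_edges [a,b,c,d] = {{a,b},{b,c},{c,d},{d,a}}"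
  and cyc_edges_6: "cyc_edges [a,b,c,d,e,f] = {{a,b},{b,c},{c,d},{d,e},{e,f},{f,a}}"
  unfolding cyc_edges_conv by (simp_all add: upt_rec)

section \<open>Maps that send cells to cells\<close>

definition cell_map :: "(complex \<Rightarrow> complex) \<Rightarrow> bool" where
  "cell_map f \<longleftrightarrow> (\<forall>F\<in>K_faces. f ` F \<in> K_faces) \<and> (\<forall>E\<in>K_edges. f ` E \<in> K_edges)"

lemma cell_map_comp: "cell_map f \<Longrightarrow> cell_map g \<Longrightarrow> cell_map (f \<circ> g)"
  unfolding cell_map_def by (metis image_comp)

lemma cell_map_vertex: "cell_map f \<Longrightarrow> v \<in> K_vertices \<Longrightarrow> f v \<in> K_vertices"
  unfolding cell_map_def K_vertices_def by blast

lemma protos_nth: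
  "protos ! 0 = [W 1 0 0 0, W 0 1 0 0, W (-1) 1 0 0, W (-1) 0 0 0, W 0 (-1) 0 0, W 1 (-1) 0 0]"
    "protos ! Suc 0 = [W 0 1 0 0, W 1 0 0 0, W 1 0 1 (-1), W 0 1 1 (-1)]"
    "protos ! 2 = [W (-1) 1 0 0, W 0 1 0 0, W 0 1 1 0, W (-1) 1 1 0]"
    "protos ! 3 = [W (-1) 0 0 0, W (-1) 1 0 0, W (-1) 1 0 1, W (-1) 0 0 1]"
    "protos ! 4 = [W 0 (-1) 0 0, W (-1) 0 0 0, W (-1) 0 (-1) 1, W 0 (-1) (-1) 1]"
    "protos ! 5 = [W 1 (-1) 0 0, W 0 (-1) 0 0, W 0 (-1) (-1) 0, W 1 (-1) (-1) 0]"
    "protos ! 6 = [W 1 0 0 0, W 1 (-1) 0 0, W 1 (-1) 0 (-1), W 1 0 0 (-1)]"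
    "protos ! 7 = [W 1 0 0 0, W 1 0 0 (-1), W 1 0 1 (-1)]"
    "protos ! 8 = [W 0 1 0 0, W 0 1 1 (-1), W 0 1 1 0]"
    "protos ! 9 = [W (-1) 1 0 0, W (-1) 1 1 0, W (-1) 1 0 1]"
    "protos ! 10 = [W (-1) 0 0 0, W (-1) 0 0 1, W (-1) 0 (-1) 1]"
    "protos ! 11 = [W 0 (-1) 0 0, W 0 (-1) (-1) 1, W 0 (-1) (-1) 0]"
    "protos ! 12 = [W 1 (-1) 0 0, W 1 (-1) (-1) 0, W 1 (-1) 0 (-1)]"
    "protos ! 13 = [W 1 0 1 (-1), W 1 1 1 (-1), W 0 1 1 (-1)]"
    "protos ! 14 = [W 1 0 0 (-1), W 1 (-1) 0 (-1), W 2 (-1) 0 (-1)]"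
  by (simp_all add: protos_def)

lemma length_protos: "length protos = 15"
  by (simp add: protos_def)

lemma protos_induct [consumes 1]:
  assumes "P \<in> set protos"
    and "R (protos ! 0)" "R (protos ! 1)" "R (protos ! 2)" "R (protos ! 3)" "R (protos ! 4)" "R (protos ! 5)" "R (protos ! 6)" "R (protos ! 7)" "R (protos ! 8)" "R (protos ! 9)" "R (protos ! 10)" "R (protos ! 11)" "R (protos ! 12)" "R (protos ! 13)" "R (protos ! 14)"
  shows "R P"
proof -
  obtain i where "i < length protos" and P: "P = protos ! i" using assms(1) unfolding in_set_conv_nth by blast
  moreover note length_protos
  ultimately have "i = 0 \<or> i = 1 \<or> i = 2 \<or> i = 3 \<or> i = 4 \<or> i = 5 \<or> i = 6 \<or> i = 7 \<or> i = 8 \<or> i = 9 \<or> i = 10 \<or> i = 11 \<or> i = 12 \<or> i = 13 \<or> i = 14" by presburger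
  then show ?thesis using assms(2-) unfolding P by (elim disjE) (simp_all only:)
qed

lemma bex_protosI: "i < 15 \<Longrightarrow> R (protos ! i) \<Longrightarrow> \<exists>P\<in>set protos. R P"
  by (rule bexI[of _ "protos ! i"]) (simp_all add: length_protos)

text \<open>Every face is a lattice translate of a prototile, so for a map that turns lattice
  translations into lattice translations 15 tiles need checking. Edges are compared as sets, so the
  image list may start at another corner or run backwards, as it does under conjugation.\<close>

lemma cell_mapI:
  assumes "\<And>P. P \<in> set protos \<Longrightarrow> \<exists>Q\<in>set protos. \<exists>m n. f ` set P = (\<lambda>z. z + lat m n) ` set Q \<and>
             image f ` cyc_edges P = image (\<lambda>z. z + lat m n) ` cyc_edges Q"
    and "\<And>m n. \<exists>m' n'. \<forall>z. f (z + lat m n) = f z + lat m' n'"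
  shows "cell_map f"
proof -
  have *: "\<exists>Q'\<in>K_face_lists. f ` set P' = set Q' \<and> image f ` cyc_edges P' = cyc_edges Q'"
    if P': "P' \<in> K_face_lists" for P'
  proof -
    obtain P m n where P: "P \<in> set protos" "P' = map (\<lambda>z. z + lat m n) P"
      using P' K_face_lists_iff by auto
    obtain Q i j where Q: "Q \<in> set protos" "f ` set P = (\<lambda>z. z + lat i j) ` set Q"
       "image f ` cyc_edges P = image (\<lambda>z. z + lat i j) ` cyc_edges Q"
      using assms(1)[OF P(1)] by blast
    obtain m' n' where f: "\<And>z. f (z + lat m n) = f z + lat m' n'" using assms(2) by metis
    let ?t = "\<lambda>z. z + lat m' n'"
    let ?Q = "map (\<lambda>z. z + lat (i+m') (j+n')) Q"
    have s: "z + lat i j + lat m' n' = z + lat (i+m') (j+n')" for z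
      by (simp only: add.assoc lat_add)
    have "f ` set P' = ?t ` (f ` set P)" unfolding P(2) set_map image_image f ..
    also have "\<dots> = set ?Q" unfolding Q(2) set_map image_image s ..
    finally have 1: "f ` set P' = set ?Q" .
    have "image f ` cyc_edges P' = image ?t ` (image f ` cyc_edges P)"
      unfolding P(2) cyc_edges_map image_image f ..
    also have "\<dots> = cyc_edges ?Q" unfolding Q(3) cyc_edges_map image_image s ..
    finally have 2: "image f ` cyc_edges P' = cyc_edges ?Q" .
    have "?Q \<in> K_face_lists" unfolding K_face_lists_iff using Q(1) by blast
    then show ?thesis by (intro bexI[of _ ?Q] conjI 1 2)
  qed
  show ?thesis
    unfolding cell_map_def K_faces_def K_edges_def
  proof (intro conjI ballI)
    fix F assume "F \<in> set ` K_face_lists"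
    then obtain P where "P \<in> K_face_lists" "F = set P" by blast
    then show "f ` F \<in> set ` K_face_lists" using *[of P] by auto
  next
    fix E assume "E \<in> \<Union> (cyc_edges ` K_face_lists)"
    then obtain P where P: "P \<in> K_face_lists" "E \<in> cyc_edges P" by blast
    then obtain Q where Q: "Q \<in> K_face_lists" "image f ` cyc_edges P = cyc_edges Q" using *[of P] by auto
    have "f ` E \<in> cyc_edges Q" unfolding Q(2)[symmetric] using P(2) by (rule imageI)
    then show "f ` E \<in> \<Union> (cyc_edges ` K_face_lists)" using Q(1) by blast
  qed
qed


lemma cell_map_translation: "cell_map (\<lambda>z. z + lat m n)"
proof (rule cell_mapI)
  show "\<exists>m' n'. \<forall>z. z + lat i j + lat m n = z + lat m n + lat m' n'" for i j
    by (rule exI[of _ i], rule exI[of _ j]) (simp add: add_ac)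
qed blast

lemma proto_matchI:
  assumes "i < 15" "f ` set P = (\<lambda>z. z + lat m n) ` set (protos ! i)"
    and "image f ` cyc_edges P = image (\<lambda>z. z + lat m n) ` cyc_edges (protos ! i)"
  shows "\<exists>Q\<in>set protos. \<exists>m n. f ` set P = (\<lambda>z. z + lat m n) ` set Q \<and>
             image f ` cyc_edges P = image (\<lambda>z. z + lat m n) ` cyc_edges Q"
  by (rule bex_protosI[of i]) (use assms in blast)+

lemma cell_map_rot: "cell_map (\<lambda>z. \<omega> * z)"
proof (rule cell_mapI)
  show "\<exists>m' n'. \<forall>z. \<omega> * (z + lat i j) = \<omega> * z + lat m' n'" for i j
    by (rule exI[of _ "-j"], rule exI[of _ "i+j"]) (simp add: distrib_left lat_rot)
  show "\<exists>Q\<in>set protos. \<exists>m n. (\<lambda>z. \<omega> * z) ` set P = (\<lambda>z. z + lat m n) ` set Q \<and>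
             image (\<lambda>z. \<omega> * z) ` cyc_edges P = image (\<lambda>z. z + lat m n) ` cyc_edges Q"
    if "P \<in> set protos" for P
    using that
    apply (rule protos_induct)
    subgoal by (rule proto_matchI[of "0" _ _ "0" "0"])
      (simp_all add: protos_nth W_rot W_plus_lat cyc_edges_6 insert_commute)
    subgoal by (rule proto_matchI[of "2" _ _ "0" "0"])
      (simp_all add: protos_nth W_rot W_plus_lat cyc_edges_4 insert_commute)
    subgoal by (rule proto_matchI[of "3" _ _ "0" "0"])
      (simp_all add: protos_nth W_rot W_plus_lat cyc_edges_4 insert_commute)
    subgoal by (rule proto_matchI[of "4" _ _ "0" "0"])
      (simp_all add: protos_nth W_rot W_plus_lat cyc_edges_4 insert_commute)
    subgoal by (rule proto_matchI[of "5" _ _ "0" "0"])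
      (simp_all add: protos_nth W_rot W_plus_lat cyc_edges_4 insert_commute)
    subgoal by (rule proto_matchI[of "6" _ _ "0" "0"])
      (simp_all add: protos_nth W_rot W_plus_lat cyc_edges_4 insert_commute)
    subgoal by (rule proto_matchI[of "1" _ _ "0" "0"])
      (simp_all add: protos_nth W_rot W_plus_lat cyc_edges_4 insert_commute)
    subgoal by (rule proto_matchI[of "8" _ _ "0" "0"])
      (simp_all add: protos_nth W_rot W_plus_lat cyc_edges_3 insert_commute)
    subgoal by (rule proto_matchI[of "9" _ _ "0" "0"])
      (simp_all add: protos_nth W_rot W_plus_lat cyc_edges_3 insert_commute)
    subgoal by (rule proto_matchI[of "10" _ _ "0" "0"])
      (simp_all add: protos_nth W_rot W_plus_lat cyc_edges_3 insert_commute)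
    subgoal by (rule proto_matchI[of "11" _ _ "0" "0"])
      (simp_all add: protos_nth W_rot W_plus_lat cyc_edges_3 insert_commute)
    subgoal by (rule proto_matchI[of "12" _ _ "0" "0"])
      (simp_all add: protos_nth W_rot W_plus_lat cyc_edges_3 insert_commute)
    subgoal by (rule proto_matchI[of "7" _ _ "0" "0"])
      (simp_all add: protos_nth W_rot W_plus_lat cyc_edges_3 insert_commute)
    \<comment> \<open>Tiles 13 and 14 are centred at \<open>lat 1 1 / 3\<close> and
      \<open>lat 2 (-1) / 3\<close>. The rotation takes the first centre to
      \<open>lat (-1) 2 / 3\<close>, which is the second one shifted by
      \<open>lat (-1) 1\<close>.\<close>
    subgoal by (rule proto_matchI[of "14" _ _ "-1" "1"])
      (simp_all add: protos_nth W_rot W_plus_lat cyc_edges_3 insert_commute)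
    subgoal by (rule proto_matchI[of "13" _ _ "0" "0"])
      (simp_all add: protos_nth W_rot W_plus_lat cyc_edges_3 insert_commute)
    done
qed

lemma cell_map_cnj: "cell_map cnj"
proof (rule cell_mapI)
  show "\<exists>m' n'. \<forall>z. cnj (z + lat i j) = cnj z + lat m' n'" for i j
    by (rule exI[of _ "i+j"], rule exI[of _ "-j"]) (simp add: lat_cnj)
  show "\<exists>Q\<in>set protos. \<exists>m n. cnj ` set P = (\<lambda>z. z + lat m n) ` set Q \<and>
             image cnj ` cyc_edges P = image (\<lambda>z. z + lat m n) ` cyc_edges Q"
    if "P \<in> set protos" for P
    using that
    apply (rule protos_induct)
    subgoal by (rule proto_matchI[of "0" _ _ "0" "0"])
      (simp_all add: protos_nth W_cnj W_plus_lat cyc_edges_6 insert_commute)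
    subgoal by (rule proto_matchI[of "6" _ _ "0" "0"])
      (simp_all add: protos_nth W_cnj W_plus_lat cyc_edges_4 insert_commute)
    subgoal by (rule proto_matchI[of "5" _ _ "0" "0"])
      (simp_all add: protos_nth W_cnj W_plus_lat cyc_edges_4 insert_commute)
    subgoal by (rule proto_matchI[of "4" _ _ "0" "0"])
      (simp_all add: protos_nth W_cnj W_plus_lat cyc_edges_4 insert_commute)
    subgoal by (rule proto_matchI[of "3" _ _ "0" "0"])
      (simp_all add: protos_nth W_cnj W_plus_lat cyc_edges_4 insert_commute)
    subgoal by (rule proto_matchI[of "2" _ _ "0" "0"])
      (simp_all add: protos_nth W_cnj W_plus_lat cyc_edges_4 insert_commute)
    subgoal by (rule proto_matchI[of "1" _ _ "0" "0"])
      (simp_all add: protos_nth W_cnj W_plus_lat cyc_edges_4 insert_commute)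
    subgoal by (rule proto_matchI[of "7" _ _ "0" "0"])
      (simp_all add: protos_nth W_cnj W_plus_lat cyc_edges_3 insert_commute)
    subgoal by (rule proto_matchI[of "12" _ _ "0" "0"])
      (simp_all add: protos_nth W_cnj W_plus_lat cyc_edges_3 insert_commute)
    subgoal by (rule proto_matchI[of "11" _ _ "0" "0"])
      (simp_all add: protos_nth W_cnj W_plus_lat cyc_edges_3 insert_commute)
    subgoal by (rule proto_matchI[of "10" _ _ "0" "0"])
      (simp_all add: protos_nth W_cnj W_plus_lat cyc_edges_3 insert_commute)
    subgoal by (rule proto_matchI[of "9" _ _ "0" "0"])
      (simp_all add: protos_nth W_cnj W_plus_lat cyc_edges_3 insert_commute)
    subgoal by (rule proto_matchI[of "8" _ _ "0" "0"])
      (simp_all add: protos_nth W_cnj W_plus_lat cyc_edges_3 insert_commute)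
    subgoal by (rule proto_matchI[of "14" _ _ "0" "0"])
      (simp_all add: protos_nth W_cnj W_plus_lat cyc_edges_3 insert_commute)
    subgoal by (rule proto_matchI[of "13" _ _ "0" "0"])
      (simp_all add: protos_nth W_cnj W_plus_lat cyc_edges_3 insert_commute)
    done
qed

lemma cell_map_rot_power: "cell_map (\<lambda>z. \<omega>^k * z)"
proof (induction k)
  case 0
  show ?case by (simp add: cell_map_def)
next
  case (Suc k)
  then show ?case using cell_map_comp[OF cell_map_rot Suc] by (simp add: o_def mult.assoc)
qed

subsection \<open>Vertices and faces of the tiling\<close>

lemma W_rot_powers:
  "\<omega>^0 * W a b c d = W a b c d" "\<omega>^1 * W a b c d = W (-b) (a+b) (-d) (c+d)"
  "\<omega>^Suc 0 * W a b c d = W (-b) (a+b) (-d) (c+d)" "\<omega>^2 * W a b c d = W (-a-b) a (-c-d) c"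
  "\<omega>^3 * W a b c d = W (-a) (-b) (-c) (-d)" "\<omega>^4 * W a b c d = W b (-a-b) d (-c-d)"
  "\<omega>^5 * W a b c d = W (a+b) (-a) (c+d) (-c)"
  by (simp_all add: eval_nat_numeral mult.assoc W_rot)

definition hexagon :: "complex set" where "hexagon = set (protos ! 0)"

lemma hexagon_eq: "hexagon = {W 1 0 0 0, W 0 1 0 0, W (-1) 1 0 0, W (-1) 0 0 0, W 0 (-1) 0 0, W 1 (-1) 0 0}"
  by (simp add: hexagon_def protos_nth)

lemma proto_face: "i < 15 \<Longrightarrow> (\<lambda>z. z + lat m n) ` set (protos ! i) \<in> K_faces"
  unfolding K_faces_iff by (rule bexI[of _ "protos ! i"]) (auto simp: length_protos)

lemma proto_face0: "i < 15 \<Longrightarrow> set (protos ! i) \<in> K_faces"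
  using proto_face[of i 0 0] by simp

lemma proto_edge:
  assumes "i < 15" "E \<in> cyc_edges (protos ! i)"
  shows "(\<lambda>z. z + lat m n) ` E \<in> K_edges"
proof -
  have "map (\<lambda>z. z + lat m n) (protos ! i) \<in> K_face_lists"
    unfolding K_face_lists_iff by (rule bexI[of _ "protos ! i"]) (use assms(1) in \<open>auto simp: length_protos\<close>)
  moreover have "(\<lambda>z. z + lat m n) ` E \<in> cyc_edges (map (\<lambda>z. z + lat m n) (protos ! i))"
    unfolding cyc_edges_map using assms(2) by (rule imageI)
  ultimately show ?thesis unfolding K_edges_def by blast
qed

lemma face_subset: "F \<in> K_faces \<Longrightarrow> F \<subseteq> K_vertices"
  unfolding K_vertices_def by blast

lemma hexagon_vertices: "hexagon \<subseteq> K_vertices" "(\<lambda>z. z + lat m n) ` hexagon \<subseteq> K_vertices"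
  using proto_face0[of 0] proto_face[of 0 m n] face_subset unfolding hexagon_def by auto

text \<open>\<open>W 1 0 0 0\<close> is the hexagon corner 1, and \<open>W 1 0 1 (-1)\<close> is 1 +
  e^(i pi/6), the outer end of a square side at that corner. Their rotations about 0 represent all
  vertices modulo the lattice.\<close>

definition vform :: "complex \<Rightarrow> bool" where
  "vform v \<longleftrightarrow> (\<exists>k<6. \<exists>u\<in>{W 1 0 0 0, W 1 0 1 (-1)}. \<exists>m n. v = \<omega>^k * u + lat m n)"

lemma vformI0: "k < 6 \<Longrightarrow> v = \<omega>^k * W 1 0 0 0 + lat m n \<Longrightarrow> vform v"
  and vformI1: "k < 6 \<Longrightarrow> v = \<omega>^k * W 1 0 1 (-1) + lat m n \<Longrightarrow> vform v"
  unfolding vform_def by blast+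

lemma vform_lat: "vform v \<Longrightarrow> vform (v + lat m n)"
proof -
  assume "vform v"
  then obtain k u i j where "k < 6" "u \<in> {W 1 0 0 0, W 1 0 1 (-1)}" and v: "v = \<omega>^k * u + lat i j"
    unfolding vform_def by blast
  moreover have "v + lat m n = \<omega>^k * u + lat (i+m) (j+n)" by (simp add: v add.assoc lat_add)
  ultimately show ?thesis unfolding vform_def by blast
qed

lemma vertex_form:
  assumes "v \<in> K_vertices" shows "vform v"
proof -
  obtain F where "F \<in> K_faces" "v \<in> F" using assms unfolding K_vertices_def by blast
  then obtain P m n where P: "P \<in> set protos" "v \<in> (\<lambda>z. z + lat m n) ` set P"
    unfolding K_faces_iff by blast
  have "vform (W 1 0 0 0)"
    by (rule vformI0[of 0 _ "0" "0"]) (simp_all add: W_rot_powers W_rot W_plus_lat)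
  moreover   have "vform (W 0 1 0 0)"
    by (rule vformI0[of 1 _ "0" "0"]) (simp_all add: W_rot_powers W_rot W_plus_lat)
  moreover   have "vform (W (-1) 1 0 0)"
    by (rule vformI0[of 2 _ "0" "0"]) (simp_all add: W_rot_powers W_rot W_plus_lat)
  moreover   have "vform (W (-1) 0 0 0)"
    by (rule vformI0[of 3 _ "0" "0"]) (simp_all add: W_rot_powers W_rot W_plus_lat)
  moreover   have "vform (W 0 (-1) 0 0)"
    by (rule vformI0[of 4 _ "0" "0"]) (simp_all add: W_rot_powers W_rot W_plus_lat)
  moreover   have "vform (W 1 (-1) 0 0)"
    by (rule vformI0[of 5 _ "0" "0"]) (simp_all add: W_rot_powers W_rot W_plus_lat)
  moreover   have "vform (W 1 0 1 (-1))"
    by (rule vformI1[of 0 _ "0" "0"]) (simp_all add: W_rot_powers W_rot W_plus_lat)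
  \<comment> \<open>An outer corner may have to be reached by rotating about a neighbouring hexagon
    centre; its position there is the shift.\<close>
  moreover   have "vform (W 0 1 1 (-1))"
    by (rule vformI1[of 4 _ "0" "1"]) (simp_all add: W_rot_powers W_rot W_plus_lat)
  moreover   have "vform (W 0 1 1 0)"
    by (rule vformI1[of 1 _ "0" "0"]) (simp_all add: W_rot_powers W_rot W_plus_lat)
  moreover   have "vform (W (-1) 1 1 0)"
    by (rule vformI1[of 5 _ "-1" "1"]) (simp_all add: W_rot_powers W_rot W_plus_lat)
  moreover   have "vform (W (-1) 1 0 1)"
    by (rule vformI1[of 2 _ "0" "0"]) (simp_all add: W_rot_powers W_rot W_plus_lat)
  moreover   have "vform (W (-1) 0 0 1)"
    by (rule vformI1[of 0 _ "-1" "0"]) (simp_all add: W_rot_powers W_rot W_plus_lat)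
  moreover   have "vform (W (-1) 0 (-1) 1)"
    by (rule vformI1[of 3 _ "0" "0"]) (simp_all add: W_rot_powers W_rot W_plus_lat)
  moreover   have "vform (W 0 (-1) (-1) 1)"
    by (rule vformI1[of 1 _ "0" "-1"]) (simp_all add: W_rot_powers W_rot W_plus_lat)
  moreover   have "vform (W 0 (-1) (-1) 0)"
    by (rule vformI1[of 4 _ "0" "0"]) (simp_all add: W_rot_powers W_rot W_plus_lat)
  moreover   have "vform (W 1 (-1) (-1) 0)"
    by (rule vformI1[of 2 _ "1" "-1"]) (simp_all add: W_rot_powers W_rot W_plus_lat)
  moreover   have "vform (W 1 (-1) 0 (-1))"
    by (rule vformI1[of 5 _ "0" "0"]) (simp_all add: W_rot_powers W_rot W_plus_lat)
  moreover   have "vform (W 1 0 0 (-1))"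
    by (rule vformI1[of 3 _ "1" "0"]) (simp_all add: W_rot_powers W_rot W_plus_lat)
  moreover   have "vform (W 1 1 1 (-1))"
    by (rule vformI1[of 2 _ "1" "0"]) (simp_all add: W_rot_powers W_rot W_plus_lat)
  moreover   have "vform (W 2 (-1) 0 (-1))"
    by (rule vformI1[of 1 _ "1" "-1"]) (simp_all add: W_rot_powers W_rot W_plus_lat)
  ultimately have "\<forall>Q\<in>set protos. \<forall>v\<in>set Q. vform v"
    by (simp add: protos_def)
  then have "\<forall>v\<in>set P. vform v" using P(1) by blast
  moreover obtain p where "p \<in> set P" "v = p + lat m n" using P(2) by blast
  ultimately show ?thesis using vform_lat[of p m n] by simp
qed

lemma K_faces_card6:
  assumes "F \<in> K_faces" "card F = 6"
  shows "\<exists>m n. F = (\<lambda>z. z + lat m n) ` hexagon"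
proof -
  obtain P m n where P: "P \<in> set protos" "F = (\<lambda>z. z + lat m n) ` set P"
    using assms(1) unfolding K_faces_iff by blast
  have "card F = card (set P)" unfolding P(2) by (rule card_image) simp
  moreover have "card (set P) = 6 \<longrightarrow> P = protos ! 0"
    by (rule protos_induct[OF P(1)]) (simp_all add: protos_nth)
  ultimately have "F = (\<lambda>z. z + lat m n) ` hexagon"
    unfolding hexagon_def P(2) using assms(2) P(2) by auto
  then show ?thesis by blast
qed

lemma face_eqI:
  assumes "F \<in> K_faces" "A \<subseteq> F"
    and "\<And>P m n. P \<in> set protos \<Longrightarrow> A \<subseteq> (\<lambda>z. z + lat m n) ` set P \<Longrightarrow> card (set P) = card F \<Longrightarrow>
           P = protos ! i \<and> m = m' \<and> n = n'"
  shows "F = (\<lambda>z. z + lat m' n') ` set (protos ! i)"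
proof -
  obtain P m n where P: "P \<in> set protos" "F = (\<lambda>z. z + lat m n) ` set P"
    using assms unfolding K_faces_iff by blast
  have "card F = card (set P)" unfolding P(2) by (rule card_image) simp
  then have "P = protos ! i \<and> m = m' \<and> n = n'" using assms(2) assms(3)[OF P(1), of m n] P(2) by metis
  then show ?thesis using P(2) by blast
qed

text \<open>Each of these three edges lies in a single square, so an injective cell map that fixes
  both its ends maps that square onto itself.\<close>

lemma square_unique:
  assumes "F \<in> K_faces" "card F = 4"
  shows "{W 1 0 0 0, W 0 1 0 0} \<subseteq> F \<Longrightarrow> F = set (protos ! 1)"
    and "{W 1 0 0 0, W 1 (-1) 0 0} \<subseteq> F \<Longrightarrow> F = set (protos ! 6)"
    and "{W 1 0 1 (-2), W 1 0 1 (-1)} \<subseteq> F \<Longrightarrow> F = (\<lambda>z. z + lat 1 0) ` set (protos ! 3)"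
proof -
  have *: "card (set P) = 4 \<longrightarrow> ({W 1 0 0 0, W 0 1 0 0} \<subseteq> (\<lambda>z. z + lat m n) ` set P \<longrightarrow> P = protos ! 1 \<and> m = 0 \<and> n = 0) \<and>
      ({W 1 0 0 0, W 1 (-1) 0 0} \<subseteq> (\<lambda>z. z + lat m n) ` set P \<longrightarrow> P = protos ! 6 \<and> m = 0 \<and> n = 0) \<and>
      ({W 1 0 1 (-2), W 1 0 1 (-1)} \<subseteq> (\<lambda>z. z + lat m n) ` set P \<longrightarrow> P = protos ! 3 \<and> m = 1 \<and> n = 0)"
    if "P \<in> set protos" for P m n
    by (rule protos_induct[OF that]) (simp_all add: protos_nth W_plus_lat, presburger+)
  show "{W 1 0 0 0, W 0 1 0 0} \<subseteq> F \<Longrightarrow> F = set (protos ! 1)"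
    using face_eqI[OF assms(1), of "{W 1 0 0 0, W 0 1 0 0}" 1 0 0] * assms(2) by simp
  show "{W 1 0 0 0, W 1 (-1) 0 0} \<subseteq> F \<Longrightarrow> F = set (protos ! 6)"
    using face_eqI[OF assms(1), of "{W 1 0 0 0, W 1 (-1) 0 0}" 6 0 0] * assms(2) by simp
  show "{W 1 0 1 (-2), W 1 0 1 (-1)} \<subseteq> F \<Longrightarrow> F = (\<lambda>z. z + lat 1 0) ` set (protos ! 3)"
    using face_eqI[OF assms(1), of "{W 1 0 1 (-2), W 1 0 1 (-1)}" 3 1 0] * assms(2) by simp
qed

text \<open>This edge separates two triangles, one at corner 1 of the hexagon about 0 and one at the
  facing corner of the hexagon about \<open>lat 1 0\<close>. The edge alone cannot tell them
  apart.\<close>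

lemma triangle_unique:
  assumes "F \<in> K_faces" "card F = 3" "{W 1 0 1 (-1), W 1 0 0 (-1)} \<subseteq> F"
  shows "F = set (protos ! 7) \<or> F = (\<lambda>z. z + lat 1 0) ` set (protos ! 10)"
proof -
  obtain P m n where P: "P \<in> set protos" "F = (\<lambda>z. z + lat m n) ` set P"
    using assms unfolding K_faces_iff by blast
  have "card F = card (set P)" unfolding P(2) by (rule card_image) simp
  then have c: "card (set P) = 3" using assms(2) by simp
  have "card (set P) = 3 \<longrightarrow> {W 1 0 1 (-1), W 1 0 0 (-1)} \<subseteq> (\<lambda>z. z + lat m n) ` set P \<longrightarrow>
      P = protos ! 7 \<and> m = 0 \<and> n = 0 \<or> P = protos ! 10 \<and> m = 1 \<and> n = 0"
    by (rule protos_induct[OF P(1)]) (simp_all add: protos_nth W_plus_lat, presburger+)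
  then show ?thesis using P(2) assms(3) c by auto
qed

subsection \<open>Combinatorial rigidity\<close>

text \<open>Injectivity on vertices keeps the number of corners of a face, so hexagons, squares and
  triangles go to tiles of the same kind.\<close>

definition auto_map :: "(complex \<Rightarrow> complex) \<Rightarrow> bool" where
  "auto_map f \<longleftrightarrow> cell_map f \<and> inj_on f K_vertices"

lemma auto_map_comp: "auto_map f \<Longrightarrow> auto_map g \<Longrightarrow> auto_map (f \<circ> g)"
proof -
  assume f: "auto_map f" and g: "auto_map g"
  have "g ` K_vertices \<subseteq> K_vertices" using g cell_map_vertex unfolding auto_map_def by blast
  then show ?thesis
    using f g unfolding auto_map_def by (metis cell_map_comp comp_inj_on inj_on_subset)
qed

lemma auto_map_affine: "auto_map (\<lambda>z. \<omega>^k * z + lat m n)"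
  and auto_map_translation: "auto_map (\<lambda>z. z + lat m n)"
  and auto_map_rot_power: "auto_map (\<lambda>z. \<omega>^k * z)"
  and auto_map_cnj: "auto_map cnj"
proof -
  have "\<omega> \<noteq> 0" using norm_omega by auto
  then show 1: "auto_map (\<lambda>z. \<omega>^k * z)" and 2: "auto_map (\<lambda>z. z + lat m n)" and "auto_map cnj"
    by (simp_all add: auto_map_def cell_map_rot_power cell_map_translation cell_map_cnj inj_on_def)
  show "auto_map (\<lambda>z. \<omega>^k * z + lat m n)"
    using auto_map_comp[OF 2 1] by (simp add: o_def)
qed

text \<open>The twelfth roots of unity: every edge has length 1 and a direction that is a multiple
  of 30 degrees.\<close>

definition units :: "complex set" where
  "units = {W 1 0 0 0, W 0 1 0 0, W (-1) 1 0 0, W (-1) 0 0 0, W 0 (-1) 0 0, W 1 (-1) 0 0,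
            W 0 0 1 0, W 0 0 0 1, W 0 0 (-1) 1, W 0 0 (-1) 0, W 0 0 0 (-1), W 0 0 1 (-1)}"

lemma W_units_iff: "W a b c d \<in> units \<longleftrightarrow> (a,b,c,d) \<in> {(1,0,0,0), (0,1,0,0), (-1,1,0,0),
    (-1,0,0,0), (0,-1,0,0), (1,-1,0,0), (0,0,1,0), (0,0,0,1), (0,0,-1,1), (0,0,-1,0), (0,0,0,-1), (0,0,1,-1)}"
  by (simp add: units_def)

lemma edge_diff_unit:
  assumes "{u,v} \<in> K_edges" "u \<noteq> v"
  shows "v - u \<in> units"
proof -
  obtain Q where Q: "Q \<in> K_face_lists" "{u,v} \<in> cyc_edges Q"
    using assms(1) unfolding K_edges_def by blast
  then obtain P m n where P: "P \<in> set protos" "Q = map (\<lambda>z. z + lat m n) P"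
    unfolding K_face_lists_iff by blast
  then obtain E where E: "E \<in> cyc_edges P" "{u,v} = (\<lambda>z. z + lat m n) ` E"
    using Q(2) unfolding P(2) cyc_edges_map by blast
  have "\<forall>E\<in>cyc_edges P. \<forall>a\<in>E. \<forall>b\<in>E. a = b \<or> b - a \<in> units"
    using P(1)
    by (rule protos_induct) (simp_all add: protos_nth cyc_edges_3 cyc_edges_4 cyc_edges_6 W_diff units_def)
  moreover obtain a b where "a \<in> E" "b \<in> E" "u = a + lat m n" "v = b + lat m n"
    using E(2) by blast
  ultimately show ?thesis using E(1) assms(2) by force
qed

text \<open>A fixed face containing a fixed vertex x propagates fixedness along an edge xy, provided
  every other vertex of the face at unit distance from x is already known to be fixed.\<close>
lemma edge_step:
  assumes f: "auto_map f" and e: "{x,y} \<in> K_edges" and x: "f x = x" and F: "f ` F \<subseteq> F"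
    and y: "y \<in> F" "x \<noteq> y" and V: "F \<subseteq> K_vertices" "x \<in> F"
    and other: "\<forall>z\<in>F. z - x \<in> units \<longrightarrow> z = y \<or> f z = z"
  shows "f y = y"
proof -
  have inj: "inj_on f K_vertices" using f by (simp add: auto_map_def)
  have "f ` {x,y} \<in> K_edges" using f e unfolding auto_map_def cell_map_def by blast
  then have "{x, f y} \<in> K_edges" using x by simp
  moreover have "f y \<noteq> x" using inj x y V by (metis inj_on_contraD subsetD)
  ultimately have "f y - x \<in> units" using edge_diff_unit by blast
  moreover have fy: "f y \<in> F" using F y by blast
  ultimately have "f y = y \<or> f (f y) = f y" using other by blast
  then show ?thesis using inj fy y V by (metis inj_onD subsetD)
qed

lemma image_face_eqI:
  assumes "auto_map f" "F \<in> K_faces"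
  shows "f ` F \<in> K_faces" "card (f ` F) = card F"
proof -
  show "f ` F \<in> K_faces" using assms unfolding auto_map_def cell_map_def by blast
  have "inj_on f F" using assms face_subset inj_on_subset unfolding auto_map_def by metis
  then show "card (f ` F) = card F" by (rule card_image)
qed

lemma edge0: "i < 15 \<Longrightarrow> E \<in> cyc_edges (protos ! i) \<Longrightarrow> E \<in> K_edges"
  using proto_edge[of i E 0 0] by simp

text \<open>A walk round the hexagon: at each corner reached, the neighbour behind is already fixed,
  so the one ahead must be fixed too.\<close>

lemma hexagon_fixed:
  assumes f: "auto_map f" and F: "f ` hexagon \<subseteq> hexagon" and 0: "f (W 1 0 0 0) = W 1 0 0 0"
    and 1: "f (W 0 1 0 0) = W 0 1 0 0"
  shows "\<forall>z\<in>hexagon. f z = z"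
proof -
  note edges = edge0[of 0, simplified protos_nth cyc_edges_6]
  have step: "f y = y" if "{x,y} \<in> K_edges" "f x = x" "y \<in> hexagon" "x \<noteq> y" "x \<in> hexagon"
      "\<forall>z\<in>hexagon. z - x \<in> units \<longrightarrow> z = y \<or> f z = z" for x y
    using edge_step[OF f that(1,2) F that(3,4) hexagon_vertices(1) that(5,6)] .
  have 2: "f (W (-1) 1 0 0) = W (-1) 1 0 0"
    by (rule step[of "W 0 1 0 0"]) (simp_all add: edges hexagon_eq 0 1 W_units_iff W_diff)
  have 3: "f (W (-1) 0 0 0) = W (-1) 0 0 0"
    by (rule step[of "W (-1) 1 0 0"]) (simp_all add: edges hexagon_eq 0 1 2 W_units_iff W_diff)
  have 4: "f (W 0 (-1) 0 0) = W 0 (-1) 0 0"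
    by (rule step[of "W (-1) 0 0 0"]) (simp_all add: edges hexagon_eq 0 1 2 3 W_units_iff W_diff)
  have 5: "f (W 1 (-1) 0 0) = W 1 (-1) 0 0"
    by (rule step[of "W 0 (-1) 0 0"]) (simp_all add: edges hexagon_eq 0 1 2 3 4 W_units_iff W_diff)
  show ?thesis using 0 1 2 3 4 5 by (simp add: hexagon_eq)
qed

text \<open>Fixedness crosses from the hexagon about 0 to the one about \<open>lat 1 0\<close>. The
  two squares at corner 1 are preserved, which fixes their outer corners; these span an edge of a
  triangle whose far corner lies on the next hexagon, and a square on that triangle gives a second
  corner of it. Symmetry supplies the other five directions.\<close>

lemma neighbour_fixed:
  assumes f: "auto_map f" and fx: "\<forall>z\<in>hexagon. f z = z"
  shows "f (W 1 0 1 (-1)) = W 1 0 1 (-1)"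
    and "\<forall>z\<in>hexagon. f (z + lat 1 0) = z + lat 1 0"
proof -
  have inj: "inj_on f K_vertices" using f by (simp add: auto_map_def)
  note face = image_face_eqI[OF f]
  have c0: "f (W 1 0 0 0) = W 1 0 0 0" and c1: "f (W 0 1 0 0) = W 0 1 0 0" and c5: "f (W 1 (-1) 0 0) = W 1 (-1) 0 0"
    using fx by (auto simp: hexagon_eq)
  have S1: "f ` set (protos ! 1) = set (protos ! 1)"
  proof (rule square_unique(1))
    show "f ` set (protos ! 1) \<in> K_faces" by (intro face proto_face0) simp
    have "card (f ` set (protos ! 1)) = card (set (protos ! 1))" by (intro face proto_face0) simp
    then show "card (f ` set (protos ! 1)) = 4" by (simp add: protos_nth)
    show "{W 1 0 0 0, W 0 1 0 0} \<subseteq> f ` set (protos ! 1)" by (simp add: protos_nth c0 c1)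
  qed
  have S6: "f ` set (protos ! 6) = set (protos ! 6)"
  proof (rule square_unique(2))
    show "f ` set (protos ! 6) \<in> K_faces" by (intro face proto_face0) simp
    have "card (f ` set (protos ! 6)) = card (set (protos ! 6))" by (intro face proto_face0) simp
    then show "card (f ` set (protos ! 6)) = 4" by (simp add: protos_nth)
    show "{W 1 0 0 0, W 1 (-1) 0 0} \<subseteq> f ` set (protos ! 6)" by (simp add: protos_nth c0 c5)
  qed
  show o0: "f (W 1 0 1 (-1)) = W 1 0 1 (-1)"
    by (rule edge_step[OF f _ c0 equalityD1[OF S1] _ _ face_subset[OF proto_face0]])
      (simp_all add: edge0[of 1] protos_nth cyc_edges_4 c0 c1 W_units_iff W_diff)
  have o0': "f (W 1 0 0 (-1)) = W 1 0 0 (-1)"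
    by (rule edge_step[OF f _ c0 equalityD1[OF S6] _ _ face_subset[OF proto_face0]])
      (simp_all add: edge0[of 6] doubleton_eq_iff protos_nth cyc_edges_4 c0 c5 W_units_iff W_diff)
  let ?t = "\<lambda>z. z + lat 1 0"
  have T: "?t ` set (protos ! 10) = {W 1 0 1 (-2), W 1 0 1 (-1), W 1 0 0 (-1)}"
    by (auto simp: protos_nth W_plus_lat)
  have Q: "?t ` set (protos ! 3) = {W 1 0 1 (-2), W 1 1 1 (-2), W 1 1 1 (-1), W 1 0 1 (-1)}"
    by (auto simp: protos_nth W_plus_lat)
  have H: "?t ` hexagon = {W 3 0 1 (-2), W 2 1 1 (-2), W 1 1 1 (-2), W 1 0 1 (-2), W 2 (-1) 1 (-2), W 3 (-1) 1 (-2)}"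
    by (auto simp: hexagon_eq W_plus_lat)
  have Tf: "?t ` set (protos ! 10) \<in> K_faces" and Qf: "?t ` set (protos ! 3) \<in> K_faces"
    and Hf: "?t ` hexagon \<in> K_faces"
    unfolding hexagon_def by (rule proto_face; simp)+
  \<comment> \<open>The image of the far triangle is one of the two triangles on the edge. In either
    case the only other candidates for the image of its third corner are vertices that f already
    fixes, and injectivity excludes them.\<close>
  have d3: "f (W 1 0 1 (-2)) = W 1 0 1 (-2)"
  proof -
    have card: "card (f ` (?t ` set (protos ! 10))) = 3"
      using face(2)[OF Tf] unfolding T by simp
    have v: "W 1 0 0 0 \<in> K_vertices" "W 1 0 1 (-2) \<in> K_vertices" "W 1 0 1 (-1) \<in> K_vertices" "W 1 0 0 (-1) \<in> K_vertices"
      using face_subset[OF Tf] hexagon_vertices(1) unfolding T by (auto simp: hexagon_eq)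
    have "f ` (?t ` set (protos ! 10)) = set (protos ! 7) \<or> f ` (?t ` set (protos ! 10)) = ?t ` set (protos ! 10)"
      by (rule triangle_unique[OF face(1)[OF Tf] card]) (auto simp: T o0 o0')
    then have "f (W 1 0 1 (-2)) \<in> {W 1 0 0 0, W 1 0 1 (-1), W 1 0 0 (-1), W 1 0 1 (-2)}"
      unfolding T by (auto simp: protos_nth)
    moreover have "f (W 1 0 1 (-2)) \<noteq> x" if "x \<in> {W 1 0 0 0, W 1 0 1 (-1), W 1 0 0 (-1)}" for x
    proof -
      have "f x = x" "x \<in> K_vertices" "x \<noteq> W 1 0 1 (-2)" using that c0 o0 o0' v by auto
      then show ?thesis using inj_onD[OF inj, of "W 1 0 1 (-2)" x] v(2) by auto
    qed
    ultimately show ?thesis by blast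
  qed
  have Qi: "f ` (?t ` set (protos ! 3)) = ?t ` set (protos ! 3)"
  proof (rule square_unique(3))
    show "f ` (?t ` set (protos ! 3)) \<in> K_faces" by (rule face(1)[OF Qf])
    show "card (f ` (?t ` set (protos ! 3))) = 4" using face(2)[OF Qf] unfolding Q by simp
    show "{W 1 0 1 (-2), W 1 0 1 (-1)} \<subseteq> f ` (?t ` set (protos ! 3))" unfolding Q by (simp add: o0 d3)
  qed
  have d2: "f (W 1 1 1 (-2)) = W 1 1 1 (-2)"
  proof (rule edge_step[OF f _ d3 equalityD1[OF Qi] _ _ face_subset[OF Qf]])
    have "?t ` {W (-1) 0 0 0, W (-1) 1 0 0} \<in> K_edges"
      by (rule proto_edge[of 3]) (auto simp: protos_nth cyc_edges_4)
    then show "{W 1 0 1 (-2), W 1 1 1 (-2)} \<in> K_edges" by (simp add: W_plus_lat)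
  qed (simp_all add: Q o0 d3 W_units_iff W_diff)
  have Hi: "f ` (?t ` hexagon) \<subseteq> ?t ` hexagon"
  proof -
    have "card (f ` (?t ` hexagon)) = 6" using face(2)[OF Hf] unfolding H by simp
    then obtain m n where mn: "f ` (?t ` hexagon) = (\<lambda>z. z + lat m n) ` hexagon"
      using K_faces_card6[OF face(1)[OF Hf]] by blast
    have "W 1 0 1 (-2) \<in> f ` (?t ` hexagon)" unfolding H by (simp add: d3)
    then have "m = 1 \<and> n = 0" unfolding mn unfolding hexagon_eq by (simp add: W_plus_lat) presburger
    then show ?thesis using mn by simp
  qed
  define g where "g = (\<lambda>z. z + lat (-1) 0) \<circ> f \<circ> (\<lambda>z. z + lat 1 0)"
  have g: "auto_map g"
    unfolding g_def by (intro auto_map_comp auto_map_translation f)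
  \<comment> \<open>The corners known to be fixed by g are \<open>W (-1) 1 0 0\<close> and
    \<open>W (-1) 0 0 0\<close>. The rotation s takes 1 and \<open>\<omega>\<close> to them, so the
    conjugate h fixes the two corners from which the walk round the hexagon starts.\<close>
  define s where "s = (\<lambda>z. \<omega>^2 * z)"
  define h where "h = (\<lambda>z. \<omega>^4 * z) \<circ> g \<circ> s"
  have h: "auto_map h"
    unfolding h_def s_def by (intro auto_map_comp auto_map_rot_power g)
  have s46: "\<omega>^4 * (\<omega>^2 * z) = z" "\<omega>^2 * (\<omega>^4 * z) = z" for z
    using omega_power6 by (simp_all add: mult.assoc[symmetric] power_add[symmetric])
  have sH: "s ` hexagon = hexagon" "(\<lambda>z. \<omega>^4 * z) ` hexagon = hexagon"
    unfolding s_def hexagon_eq by (auto simp: W_rot_powers)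
  have "g ` hexagon \<subseteq> hexagon"
  proof -
    have "(\<lambda>z. z + lat (-1) 0) ` (f ` (?t ` hexagon)) \<subseteq> (\<lambda>z. z + lat (-1) 0) ` (?t ` hexagon)"
      using Hi by blast
    also have "(\<lambda>z. z + lat (-1) 0) ` (?t ` hexagon) = hexagon"
      by (simp add: image_image add.assoc lat_add)
    finally show ?thesis by (simp add: g_def image_comp)
  qed
  then have "h ` hexagon \<subseteq> hexagon"
    unfolding h_def image_comp[symmetric] sH(1) using image_mono[of "g ` hexagon" hexagon "\<lambda>z. \<omega>^4 * z"] sH(2) by simp
  moreover have "h (W 1 0 0 0) = W 1 0 0 0" "h (W 0 1 0 0) = W 0 1 0 0"
    by (simp_all add: h_def g_def s_def W_rot_powers W_plus_lat d2 d3)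
  ultimately have "\<forall>z\<in>hexagon. h z = z"
    using hexagon_fixed[OF h] by blast
  have "g (s z) = s z" if "z \<in> hexagon" for z
  proof -
    have "\<omega>^2 * h z = \<omega>^2 * z" using \<open>\<forall>z\<in>hexagon. h z = z\<close> that by simp
    then show ?thesis by (simp add: h_def s_def s46 omega_power6)
  qed
  then have "\<forall>z\<in>s ` hexagon. g z = z" by blast
  then have gH: "\<forall>z\<in>hexagon. g z = z" using sH(1) by simp
  show "\<forall>z\<in>hexagon. f (z + lat 1 0) = z + lat 1 0"
  proof
    fix z assume "z \<in> hexagon"
    then have "f (z + lat 1 0) + lat (-1) 0 = z" using gH by (simp add: g_def)
    then have "f (z + lat 1 0) + lat (-1) 0 + lat 1 0 = z + lat 1 0" by simp
    then show "f (z + lat 1 0) = z + lat 1 0" by (simp add: add.assoc lat_add)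
  qed
qed


text \<open>The inverse rotation is written as a natural power, so it is again one of the rotations
  known to preserve cells.\<close>

lemma omega_inverse: "\<omega>^k * ((\<omega>^5)^k * z) = z" "(\<omega>^5)^k * (\<omega>^k * z) = z"
proof -
  have "\<omega>^5 * \<omega> = 1" using omega_power6 by (simp add: eval_nat_numeral mult_ac)
  then have "(\<omega>^5)^k * \<omega>^k = 1" by (simp flip: power_mult_distrib)
  then show "(\<omega>^5)^k * (\<omega>^k * z) = z" "\<omega>^k * ((\<omega>^5)^k * z) = z"
    by (metis mult.assoc mult_1, metis mult.assoc mult.commute mult_1)
qed

lemma hexagon_rot: "z \<in> hexagon \<Longrightarrow> \<omega>^k * z \<in> hexagon"
proof (induction k)
  case (Suc k)
  then have "\<omega>^k * z \<in> hexagon" by simp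
  then have "\<omega> * (\<omega>^k * z) \<in> hexagon" unfolding hexagon_eq by (auto simp: W_rot)
  then show ?case by (simp add: mult.assoc)
qed auto

lemma hexagon_omega: "z \<in> hexagon \<longleftrightarrow> (\<exists>k<6. z = \<omega>^k)"
proof -
  have 1: "W 1 0 0 0 = 1" by (simp add: W_def)
  have "{..<6::nat} = {0,1,2,3,4,5}" by auto
  then have "(\<exists>k<6. z = \<omega>^k) \<longleftrightarrow> z \<in> (\<lambda>k. \<omega>^k * W 1 0 0 0) ` {0,1,2,3,4,5}" 
    unfolding 1 by (metis (no_types, lifting) image_iff lessThan_iff mult.right_neutral)
  also have "(\<lambda>k. \<omega>^k * W 1 0 0 0) ` {0,1,2,3,4,5::nat} = hexagon"
    unfolding hexagon_eq by (simp only: image_insert image_empty W_rot_powers) simp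
  finally show ?thesis by simp
qed

text \<open>Conjugation by a symmetry of the tiling carries the crossing at corner 1 of the central
  hexagon to any corner of any hexagon.\<close>

lemma neighbours_fixed:
  assumes f: "auto_map f" and fx: "\<forall>z\<in>hexagon. f (z + lat m n) = z + lat m n"
  shows "f (\<omega>^k * W 1 0 1 (-1) + lat m n) = \<omega>^k * W 1 0 1 (-1) + lat m n"
    and "\<forall>z\<in>hexagon. f (z + (\<omega>^k * lat 1 0 + lat m n)) = z + (\<omega>^k * lat 1 0 + lat m n)"
proof -
  let ?s = "\<lambda>z. \<omega>^k * z + lat m n" and ?r = "\<lambda>z. (\<omega>^5)^k * (z + lat (-m) (-n))"
  have rs: "?r (?s z) = z" and sr: "?s (?r z) = z" for z
    by (simp_all only: add.assoc lat_add omega_inverse) (simp_all add: omega_inverse)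
  have r: "auto_map ?r"
  proof -
    have "?r = (\<lambda>z. \<omega>^(5*k) * z) \<circ> (\<lambda>z. z + lat (-m) (-n))" by (simp add: fun_eq_iff power_mult)
    then show ?thesis using auto_map_comp auto_map_rot_power auto_map_translation by metis
  qed
  define h where "h = ?r \<circ> f \<circ> ?s"
  have h: "auto_map h" unfolding h_def by (intro auto_map_comp r f auto_map_affine)
  have hx: "\<forall>z\<in>hexagon. h z = z"
    using fx hexagon_rot rs by (simp add: h_def)
  have fs: "f (?s z) = ?s z" if "h z = z" for z
    using that sr unfolding h_def by (metis comp_apply)
  show "f (?s (W 1 0 1 (-1))) = ?s (W 1 0 1 (-1))"
    by (intro fs neighbour_fixed(1)[OF h hx])
  show "\<forall>z\<in>hexagon. f (z + (\<omega>^k * lat 1 0 + lat m n)) = z + (\<omega>^k * lat 1 0 + lat m n)"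
  proof
    fix z assume z: "z \<in> hexagon"
    define y where "y = (\<omega>^5)^k * z"
    have y: "y \<in> hexagon" unfolding y_def power_mult[symmetric] using hexagon_rot z by blast
    have zy: "z = \<omega>^k * y" by (simp add: y_def omega_inverse)
    have "f (?s (y + lat 1 0)) = ?s (y + lat 1 0)"
      using fs neighbour_fixed(2)[OF h hx] y by blast
    then show "f (z + (\<omega>^k * lat 1 0 + lat m n)) = z + (\<omega>^k * lat 1 0 + lat m n)"
      by (simp add: zy distrib_left add.assoc)
  qed
qed

text \<open>The steps to neighbouring hexagons generate the lattice, so all hexagons are fixed
  pointwise, and every other vertex is an outer corner next to one of them.\<close>

lemma rigid:
  assumes f: "auto_map f" and fx: "\<forall>z\<in>hexagon. f z = z" and v: "v \<in> K_vertices"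
  shows "f v = v"
proof -
  let ?P = "\<lambda>m n. \<forall>z\<in>hexagon. f (z + lat m n) = z + lat m n"
  \<comment> \<open>The powers 0, 3, 1, 4 of \<open>\<omega>\<close> turn \<open>lat 1 0\<close>
    into \<open>lat 1 0\<close>, \<open>lat (-1) 0\<close>, \<open>lat 0 1\<close>,
    \<open>lat 0 (-1)\<close>.\<close>
  have step: "?P (m+1) n" "?P (m-1) n" "?P m (n+1)" "?P m (n-1)" if "?P m n" for m n
    using neighbours_fixed(2)[OF f that, of 0] neighbours_fixed(2)[OF f that, of 3]
      neighbours_fixed(2)[OF f that, of 1] neighbours_fixed(2)[OF f that, of 4]
    by (simp_all add: lat_rot lat_add lat_minus omega_power3 eval_nat_numeral mult.assoc add.commute)
  have a: "?P m 0" for m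
  proof (induction m rule: int_induct[where k=0])
    case base
    show ?case using fx by simp
  qed (use step in auto)
  have P: "?P m n" for m n
  proof (induction n rule: int_induct[where k=0])
    case base
    show ?case by (rule a)
  qed (use step in auto)
  obtain k u m n where v: "k < 6" "u \<in> {W 1 0 0 0, W 1 0 1 (-1)}" "v = \<omega>^k * u + lat m n"
    using vertex_form[OF v] unfolding vform_def by blast
  from v(2) show ?thesis
  proof (elim insertE emptyE)
    assume u: "u = W 1 0 0 0"
    have "\<omega>^k * u \<in> hexagon" unfolding u by (rule hexagon_rot) (simp add: hexagon_eq)
    then show ?thesis using P v(3) by simp
  next
    assume u: "u = W 1 0 1 (-1)"
    show ?thesis unfolding v(3) u by (rule neighbours_fixed(1)[OF f P])
  qed
qed

text \<open>Normalisation by known symmetries: translate the image of the central hexagon back to 0,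
  then rotate the image of 1 back to 1. The image of \<open>\<omega>\<close> is then one of the two
  neighbours of 1 on the hexagon, and conjugation removes the wrong choice, after which rigidity
  applies.\<close>

lemma auto_map_cases:
  assumes f: "auto_map f"
  obtains (rotation) k m n where "\<And>v. v \<in> K_vertices \<Longrightarrow> f v = \<omega>^k * v + lat m n"
    | (reflection) k m n where "\<And>v. v \<in> K_vertices \<Longrightarrow> f v = \<omega>^k * cnj v + lat m n"
proof -
  have H: "hexagon \<in> K_faces" using proto_face0[of 0] by (simp add: hexagon_def)
  have "card (f ` hexagon) = 6" using image_face_eqI(2)[OF f H] by (simp add: hexagon_eq)
  then obtain m n where mn: "f ` hexagon = (\<lambda>z. z + lat m n) ` hexagon"
    using K_faces_card6[OF image_face_eqI(1)[OF f H]] by blast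
  define f1 where "f1 = (\<lambda>z. z + lat (-m) (-n)) \<circ> f"
  have f1: "auto_map f1" unfolding f1_def by (intro auto_map_comp auto_map_translation f)
  have "(\<lambda>z. z + lat (-m) (-n)) ` (f ` hexagon) = hexagon"
    unfolding mn by (simp add: image_image add.assoc lat_add)
  then have f1H: "f1 ` hexagon = hexagon" by (simp add: f1_def image_comp)
  have c0: "W 1 0 0 0 \<in> hexagon" "W 0 1 0 0 \<in> hexagon" by (auto simp: hexagon_eq)
  then obtain k where k: "f1 (W 1 0 0 0) = \<omega>^k" using f1H hexagon_omega by blast
  define f2 where "f2 = (\<lambda>z. \<omega>^(5*k) * z) \<circ> f1"
  have f2: "auto_map f2" unfolding f2_def by (intro auto_map_comp auto_map_rot_power f1)
  have f2H: "f2 ` hexagon \<subseteq> hexagon" using f1H hexagon_rot unfolding f2_def by auto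
  have undo: "f v = \<omega>^k * f2 v + lat m n" for v
    by (simp add: f2_def f1_def power_mult omega_inverse add.assoc lat_add)
  have one: "W 1 0 0 0 = 1" by (simp add: W_def)
  have f20: "f2 (W 1 0 0 0) = W 1 0 0 0"
    using omega_inverse(2)[of k 1] by (simp add: f2_def k[unfolded one] one power_mult)
  have inj: "inj_on f2 K_vertices" using f2 by (simp add: auto_map_def)
  have "f2 (W 0 1 0 0) \<noteq> f2 (W 1 0 0 0)"
    using inj_onD[OF inj, of "W 0 1 0 0" "W 1 0 0 0"] c0 hexagon_vertices(1) by auto
  then have ne: "f2 (W 0 1 0 0) \<noteq> W 1 0 0 0" using f20 by simp
  have "{W 1 0 0 0, W 0 1 0 0} \<in> K_edges"
    by (rule edge0[of 0]) (simp_all add: protos_nth cyc_edges_6)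
  then have "f2 ` {W 1 0 0 0, W 0 1 0 0} \<in> K_edges"
    using f2 unfolding auto_map_def cell_map_def by blast
  then have "{W 1 0 0 0, f2 (W 0 1 0 0)} \<in> K_edges" using f20 by simp
  then have "f2 (W 0 1 0 0) - W 1 0 0 0 \<in> units" using edge_diff_unit ne by metis
  moreover have "f2 (W 0 1 0 0) \<in> hexagon" using f2H c0 by blast
  moreover have "\<forall>z\<in>hexagon. z - W 1 0 0 0 \<in> units \<longrightarrow> z = W 1 0 0 0 \<or> z = W 0 1 0 0 \<or> z = W 1 (-1) 0 0"
    by (simp add: hexagon_eq W_diff W_units_iff)
  ultimately have "f2 (W 0 1 0 0) = W 0 1 0 0 \<or> f2 (W 0 1 0 0) = W 1 (-1) 0 0" using ne by blast
  then show ?thesis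
  proof
    assume "f2 (W 0 1 0 0) = W 0 1 0 0"
    then have "\<forall>z\<in>hexagon. f2 z = z" by (intro hexagon_fixed f2 f2H f20)
    then show ?thesis using rigid[OF f2] undo by (intro rotation[of k m n]) simp
  next
    assume f21: "f2 (W 0 1 0 0) = W 1 (-1) 0 0"
    define f3 where "f3 = cnj \<circ> f2"
    have f3: "auto_map f3" unfolding f3_def by (intro auto_map_comp auto_map_cnj f2)
    have "cnj ` hexagon \<subseteq> hexagon" by (auto simp: hexagon_eq W_cnj)
    then have "f3 ` hexagon \<subseteq> hexagon" using f2H unfolding f3_def by auto
    then have "\<forall>z\<in>hexagon. f3 z = z"
      by (intro hexagon_fixed f3) (simp_all add: f3_def f20 f21 W_cnj)
    then have "cnj (f2 v) = v" if "v \<in> K_vertices" for v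
      using rigid[OF f3 _ that] by (simp add: f3_def)
    then have "f2 v = cnj v" if "v \<in> K_vertices" for v
      using that by (metis complex_cnj_cnj)
    then show ?thesis using undo by (intro reflection[of k m n]) simp
  qed
qed

subsection \<open>The tiles cover the plane\<close>

definition covered :: "complex \<Rightarrow> bool" where
  "covered z \<longleftrightarrow> (\<exists>F\<in>K_faces. z \<in> convex hull F)"

lemma covered_linear:
  assumes "covered z" "linear f" "cell_map f"
  shows "covered (f z)"
proof -
  obtain F where "F \<in> K_faces" "z \<in> convex hull F" using assms(1) unfolding covered_def by blast
  then have "f z \<in> convex hull (f ` F)" "f ` F \<in> K_faces"
    using convex_hull_linear_image[OF assms(2)] assms(3) unfolding cell_map_def by blast+
  then show ?thesis unfolding covered_def by blast
qed

lemma hull_translation: "convex hull ((\<lambda>z. z + a) ` F) = (\<lambda>z. z + a) ` (convex hull F)" for a :: "'a::real_vector"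
  using convex_hull_translation[of a F] by (simp add: add.commute)

lemma covered_lat: 
  assumes "covered z" shows "covered (z + lat m n)"
proof -
  obtain F where "F \<in> K_faces" "z \<in> convex hull F" using assms(1) unfolding covered_def by blast
  then have "z + lat m n \<in> convex hull ((\<lambda>z. z + lat m n) ` F)" "(\<lambda>z. z + lat m n) ` F \<in> K_faces"
    using cell_map_translation unfolding cell_map_def by (auto simp: hull_translation)
  then show ?thesis unfolding covered_def by blast
qed

lemma covered_rot: "covered z \<Longrightarrow> covered (\<omega>^k * z)"
  by (rule covered_linear) (auto simp: cell_map_rot_power linear_times)

lemma covered_cnj: "covered z \<Longrightarrow> covered (cnj z)"
  by (rule covered_linear) (auto simp: cell_map_cnj bounded_linear.linear bounded_linear_cnj)

definition ell :: real where "ell = 2 + sqrt 3"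

lemma ell_pos: "ell > 0" "ell \<ge> 2" by (simp_all add: ell_def add_pos_nonneg)

text \<open>Oblique real coordinates along the two lattice directions, in which lattice points are
  the integer multiples of \<open>ell\<close>.\<close>

definition B :: "real \<Rightarrow> real \<Rightarrow> complex" where "B x y = of_real x + of_real y * \<omega>"

lemma B_Re: "Re (B x y) = x + y/2" and B_Im: "Im (B x y) = y * sqrt 3 / 2"
  by (simp_all add: B_def \<omega>_def)

lemma lat_B: "lat m n = B (of_int m * ell) (of_int n * ell)"
  by (simp add: complex_eq_iff B_Re B_Im lat_def W_Re W_Im ell_def field_simps)

lemma convex_comb3:
  assumes "a \<in> S" "b \<in> S" "c \<in> S" "u \<ge> 0" "v \<ge> 0" "w \<ge> 0" "u + v + w = 1"
  shows "u *\<^sub>R a + v *\<^sub>R b + w *\<^sub>R c \<in> convex hull S"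
proof -
  have "u *\<^sub>R a + v *\<^sub>R b + w *\<^sub>R c \<in> convex hull {a,b,c}"
    unfolding convex_hull_3 using assms(4-) by blast
  moreover have "{a,b,c} \<subseteq> S" using assms(1-3) by blast
  ultimately show ?thesis using hull_mono[of "{a,b,c}" S convex] by blast
qed

text \<open>The inequalities cut out the triangle with corners 0, the midpoint of the lattice edge
  from 0 to L1, and the centroid of the lattice triangle 0, L1, L2. It is a fundamental domain of
  the full symmetry group, and tiles 0, 1, 7 and 13 cover it.\<close>

lemma covered_fundamental:
  assumes "0 \<le> y" "y \<le> x" "2*x + y \<le> ell"
  shows "covered (B x y)"
proof -
  define s where "s = sqrt (3::real)"
  have ss: "s * s = 3" and s1: "1 \<le> s" by (simp_all add: s_def)
  have ell: "ell = 2 + s" by (simp add: ell_def s_def)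
  note coords = complex_eq_iff B_Re B_Im W_Re W_Im s_def[symmetric]
  \<comment> \<open>The dividing lines carry the hexagon edge from 1 to \<open>\<omega>\<close>, the
    side of square 1 that starts at 1, and the side of that square opposite the hexagon.\<close>
  consider (hex) "x + y \<le> 1" | (square) "x + y \<ge> 1" "x - y \<le> 1" "(x+y-1)* s \<le> 2"
    | (corner) "x - y \<ge> 1" | (outer) "(x+y-1)* s \<ge> 2" by linarith
  then show ?thesis
  proof cases
    case hex
    \<comment> \<open>The spare weight 1 - x - y is split evenly between the opposite corners 1 and
      -1, where it cancels.\<close>
    have "(x + (1-x-y)/2) *\<^sub>R W 1 0 0 0 + y *\<^sub>R W 0 1 0 0 + ((1-x-y)/2) *\<^sub>R W (-1) 0 0 0 \<in> convex hull (set (protos ! 0))"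
      by (rule convex_comb3) (use hex assms in \<open>auto simp: protos_nth\<close>)
    moreover have "(x + (1-x-y)/2) *\<^sub>R W 1 0 0 0 + y *\<^sub>R W 0 1 0 0 + ((1-x-y)/2) *\<^sub>R W (-1) 0 0 0 = B x y"
      by (simp add: coords field_simps)
    ultimately show ?thesis unfolding covered_def using proto_face0[of 0] by auto
  next
    case square
    \<comment> \<open>g is the distance of the point from the hexagon edge, p its foot on that edge,
      and q the point opposite p on the far side of the square.\<close>
    define g where "g = (x+y-1)* s/2"
    have g: "0 \<le> g" "g \<le> 1" using square s1 by (auto simp: g_def)
    have gs: "g * s = 3*(x+y-1)/2" using ss by (simp add: g_def mult.assoc)
    define H where "H = convex hull (set (protos ! 1))"
    define p where "p = ((1+x-y)/2) *\<^sub>R W 1 0 0 0 + ((1+y-x)/2) *\<^sub>R W 0 1 0 0"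
    define q where "q = ((1+x-y)/2) *\<^sub>R W 1 0 1 (-1) + ((1+y-x)/2) *\<^sub>R W 0 1 1 (-1)"
    have conv: "convex H" and sub: "set (protos ! 1) \<subseteq> H" unfolding H_def by (auto simp: hull_subset)
    have "p \<in> H" "q \<in> H"
      unfolding p_def q_def using sub square(2) assms(2)
      by (auto intro!: convexD[OF conv] simp: protos_nth field_simps)
    then have "(1-g) *\<^sub>R p + g *\<^sub>R q \<in> H" using g by (auto intro!: convexD[OF conv])
    moreover have "(1-g) *\<^sub>R p + g *\<^sub>R q = p + g *\<^sub>R W 0 0 1 (-1)"
    proof -
      have "q = p + W 0 0 1 (-1)" unfolding p_def q_def by (simp add: coords field_simps)
      then show ?thesis by (simp add: algebra_simps)
    qed
    moreover have "p + g *\<^sub>R W 0 0 1 (-1) = B x y"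
      using gs unfolding p_def by (simp add: coords) (simp add: g_def field_simps)
    ultimately show ?thesis unfolding covered_def H_def using proto_face0[of 1] by auto
  next
    case corner
    \<comment> \<open>t and \<open>s*y + t\<close> are the barycentric weights at the two outer
      corners of the triangle. The remaining weight at corner 1, multiplied by s, equals
      \<open>ell - 2*x - y\<close>.\<close>
    define t where "t = (x-y-1)* s/3"
    have ts: "t * s = x-y-1" using ss by (simp add: t_def mult.assoc)
    have t0: "0 \<le> t" using corner s1 by (simp add: t_def)
    have sy: "0 \<le> s*y" using assms s1 by simp
    have "(1 - (s*y + 2*t)) * s = s - (y * (s * s) + 2 * (t * s))"
      by (simp add: algebra_simps)
    also have "\<dots> = s - (3*y + 2*(x-y-1))" unfolding ss ts by simp
    also have "\<dots> \<ge> 0" using assms(3) ell by simp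
    finally have le: "0 \<le> 1 - (s*y + 2*t)" using s1 by (simp add: zero_le_mult_iff)
    have "(1 - (s*y + 2*t)) *\<^sub>R W 1 0 0 0 + (s*y + t) *\<^sub>R W 1 0 1 (-1) + t *\<^sub>R W 1 0 0 (-1) \<in> convex hull (set (protos ! 7))"
      by (rule convex_comb3) (use t0 sy le in \<open>auto simp: protos_nth\<close>)
    moreover have "(1 - (s*y + 2*t)) *\<^sub>R W 1 0 0 0 + (s*y + t) *\<^sub>R W 1 0 1 (-1) + t *\<^sub>R W 1 0 0 (-1) = B x y"
    proof -
      have sz: "s * (s * z) = 3 * z" for z unfolding mult.assoc[symmetric] ss ..
      have x: "x = 1 + y + t * s" using ts by simp
      show ?thesis unfolding x by (simp add: coords) (simp add: field_simps sz)
    qed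
    ultimately show ?thesis unfolding covered_def using proto_face0[of 7] by auto
  next
    case outer
    have "(x+y-1)* s * s \<ge> 2 * s" using outer s1 by (intro mult_right_mono) auto
    then have o: "3*(x+y-1) \<ge> 2 * s" using ss by (simp add: mult.assoc)
    have "(1 + s/3 - y) *\<^sub>R W 1 0 1 (-1) + (1 + s/3 - x) *\<^sub>R W 0 1 1 (-1) + (x+y-1-2* s/3) *\<^sub>R W 1 1 1 (-1) \<in> convex hull (set (protos ! 13))"
      by (rule convex_comb3) (use o assms ell in \<open>auto simp: protos_nth\<close>)
    moreover have "(1 + s/3 - y) *\<^sub>R W 1 0 1 (-1) + (1 + s/3 - x) *\<^sub>R W 0 1 1 (-1) + (x+y-1-2* s/3) *\<^sub>R W 1 1 1 (-1) = B x y"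
    proof -
      have sz: "s * (s * z) = 3 * z" for z unfolding mult.assoc[symmetric] ss ..
      show ?thesis by (simp add: coords) (simp add: field_simps sz ss)
    qed
    ultimately show ?thesis unfolding covered_def using proto_face0[of 13] by auto
  qed
qed

lemma covered_swap: "covered (B x y) \<Longrightarrow> covered (B y x)"
proof -
  assume "covered (B x y)"
  then have "covered (\<omega>^1 * cnj (B x y))" by (intro covered_rot covered_cnj)
  also have "\<omega>^1 * cnj (B x y) = of_real x * \<omega> + of_real y * (\<omega> * cnj \<omega>)" by (simp add: B_def algebra_simps)
  also have "\<dots> = B y x" by (simp add: omega_mult_cnj B_def)
  finally show ?thesis .
qed

text \<open>The map \<open>\<omega>^2 * z + lat 1 0\<close> rotates the lattice triangle 0, L1, L2
  about its centroid and thus permutes the barycentric coordinates x, y, ell - x - y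
  cyclically.\<close>

lemma covered_cycle: "covered (B x y) \<Longrightarrow> covered (B (ell - x - y) x)"
proof -
  assume "covered (B x y)"
  then have "covered (\<omega>^2 * B x y + lat 1 0)" by (intro covered_rot covered_lat)
  also have "\<omega>^2 * B x y = of_real x * (\<omega> * \<omega>) + of_real y * \<omega>^3" by (simp add: B_def eval_nat_numeral algebra_simps)
  also have "\<dots> + lat 1 0 = B (ell - x - y) x" unfolding omega_sq omega_power3 lat_B by (simp add: B_def algebra_simps)
  finally show ?thesis .
qed

text \<open>The fundamental triangle is the chamber y \<le> x \<le> z of the barycentric
  coordinates. The swap of x and y and the 3-cycle generate all permutations, so each of the six
  orders reduces to it.\<close>

lemma covered_triangle:
  assumes "0 \<le> x" "0 \<le> y" "x + y \<le> ell"
  shows "covered (B x y)"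
proof -
  define z where "z = ell - x - y"
  have sorted: "covered (B x y)" if "0 \<le> y" "y \<le> x" "x \<le> z" "x + y + z = ell" for x y z
    using covered_fundamental[of y x] that by simp
  have c1: "covered (B x y)" if "covered (B y z)" "x + y + z = ell" for x y z
    using covered_cycle[OF that(1)] that(2) by (simp add: algebra_simps) (metis add_diff_cancel_right' add.commute add.left_commute diff_diff_eq)
  have all: "0 \<le> x" "0 \<le> y" "0 \<le> z" "x + y + z = ell" using assms by (auto simp: z_def)
  consider "y \<le> x" "x \<le> z" | "x \<le> y" "y \<le> z" | "z \<le> y" "y \<le> x" | "y \<le> z" "z \<le> x" | "z \<le> x" "x \<le> y" | "x \<le> z" "z \<le> y"
    by linarith
  then show ?thesis
  proof cases
    case 1 then show ?thesis using sorted all by blast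
  next
    case 2 then show ?thesis using sorted[of x y z] covered_swap[of y x] all by simp
  next
    case 3
    then have "covered (B y z)" using sorted[of z y x] all by simp
    then show ?thesis using c1 all by blast
  next
    case 4
    then have "covered (B z y)" using sorted[of y z x] all by simp
    then have "covered (B y z)" by (rule covered_swap)
    then show ?thesis using c1 all by blast
  next
    case 5
    then have "covered (B x z)" using sorted[of z x y] all by simp
    then have "covered (B z x)" by (rule covered_swap)
    then have "covered (B y z)" using c1[of z x y] all by simp
    then show ?thesis using c1 all by blast
  next
    case 6
    then have "covered (B z x)" using sorted[of x z y] all by simp
    then have "covered (B y z)" using c1[of z x y] all by simp
    then show ?thesis using c1 all by blast
  qed
qed

text \<open>Floors move z into a lattice parallelogram, and the half-turn about its centre takes the
  upper half to the lattice triangle already covered.\<close>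

lemma faces_cover: "covered z"
proof -
  define y where "y = Im z * 2 / sqrt 3"
  define x where "x = Re z - y / 2"
  have z: "z = B x y" by (simp add: complex_eq_iff B_Re B_Im x_def y_def)
  define m n where "m = \<lfloor>x / ell\<rfloor>" and "n = \<lfloor>y / ell\<rfloor>"
  define x' y' where "x' = x - of_int m * ell" and "y' = y - of_int n * ell"
  have zz: "z = B x' y' + lat m n" by (simp add: z lat_B B_def x'_def y'_def algebra_simps)
  have x': "0 \<le> x'" "x' \<le> ell" and y': "0 \<le> y'" "y' \<le> ell"
  proof -
    have "of_int m \<le> x / ell" "x / ell \<le> of_int m + 1" "of_int n \<le> y / ell" "y / ell \<le> of_int n + 1"
      by (simp_all add: m_def n_def)
    then show "0 \<le> x'" "x' \<le> ell" "0 \<le> y'" "y' \<le> ell"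
      using ell_pos(1) by (simp_all add: x'_def y'_def field_simps)
  qed
  have "covered (B x' y')"
  proof (cases "x' + y' \<le> ell")
    case True
    then show ?thesis using covered_triangle x' y' by blast
  next
    case False
    then have "covered (B (ell - x') (ell - y'))" using x' y' by (intro covered_triangle) auto
    then have "covered (\<omega>^3 * B (ell - x') (ell - y') + lat 1 1)" by (intro covered_rot covered_lat)
    also have "\<omega>^3 * B (ell - x') (ell - y') + lat 1 1 = B x' y'"
      by (simp add: omega_power3 lat_B B_def algebra_simps)
    finally show ?thesis .
  qed
  then show ?thesis unfolding zz by (rule covered_lat)
qed

section \<open>Bounded tiles and discreteness of the vertices\<close>

lemma face_hulls_bounded:
  obtains D where "\<And>F u v. F \<in> K_faces \<Longrightarrow> u \<in> convex hull F \<Longrightarrow> v \<in> convex hull F \<Longrightarrow> dist u v \<le> D"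
proof -
  have "bounded (\<Union>P\<in>set protos. convex hull (set P))"
    by (intro bounded_UN ballI bounded_convex_hull finite_imp_bounded finite_set)
  then obtain M where M: "\<And>P z. P \<in> set protos \<Longrightarrow> z \<in> convex hull (set P) \<Longrightarrow> norm z \<le> M"
    unfolding bounded_iff by blast
  show ?thesis
  proof
    fix F u v assume "F \<in> K_faces" and uv: "u \<in> convex hull F" "v \<in> convex hull F"
    then obtain P m n where P: "P \<in> set protos" "F = (\<lambda>z. z + lat m n) ` set P" unfolding K_faces_iff by blast
    obtain a b where ab: "a \<in> convex hull (set P)" "b \<in> convex hull (set P)" "u = a + lat m n" "v = b + lat m n"
      using uv unfolding P(2) hull_translation by blast
    have "dist u v = norm (a - b)" by (simp add: ab dist_norm)
    also have "\<dots> \<le> norm a + norm b" by (rule norm_triangle_ineq4)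
    also have "\<dots> \<le> M + M" using M[OF P(1)] ab by (intro add_mono) auto
    finally show "dist u v \<le> M + M" .
  qed
qed

lemma lat_norm_bounds: "\<bar>of_int n\<bar> \<le> norm (lat m n)" "\<bar>of_int m\<bar> \<le> 2 * norm (lat m n)"
proof -
  have s: "1 \<le> sqrt (3::real)" by simp
  have "\<bar>of_int n\<bar> * 1 \<le> \<bar>of_int n\<bar> * (ell * sqrt 3 / 2)"
    using ell_pos(2) s by (intro mult_left_mono) (simp_all add: mult_mono[of 2 ell 1 "sqrt 3", simplified])
  also have "\<dots> = \<bar>Im (lat m n)\<bar>" using ell_pos(1) by (simp add: lat_B B_Im abs_mult)
  also have "\<dots> \<le> norm (lat m n)" by (rule abs_Im_le_cmod)
  finally show n: "\<bar>of_int n\<bar> \<le> norm (lat m n)" by simp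
  have "\<bar>of_int m + of_int n / 2\<bar> * 1 \<le> \<bar>of_int m + of_int n / 2\<bar> * ell"
    using ell_pos(2) by (intro mult_left_mono) auto
  also have "\<dots> = \<bar>(of_int m + of_int n / 2) * ell\<bar>" using ell_pos(1) by (simp add: abs_mult)
  also have "(of_int m + of_int n / 2) * ell = Re (lat m n)" by (simp add: lat_B B_Re algebra_simps)
  also have "\<bar>Re (lat m n)\<bar> \<le> norm (lat m n)" by (rule abs_Re_le_cmod)
  finally have "\<bar>of_int m + of_int n / 2\<bar> \<le> norm (lat m n)" by simp
  moreover have "\<bar>of_int m\<bar> \<le> \<bar>of_int m + of_int n / 2\<bar> + \<bar>of_int n / 2 :: real\<bar>"
    using abs_triangle_ineq4[of "of_int m + of_int n / 2" "of_int n / 2 :: real"] by simp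
  ultimately show "\<bar>of_int m\<bar> \<le> 2 * norm (lat m n)" using n norm_ge_zero[of "lat m n"] by simp
qed

lemma finite_vertices_cball: "finite (K_vertices \<inter> cball 0 R)"
proof -
  \<comment> \<open>3 bounds the norm of the two vertex representatives, and 2 is the larger factor
    in the estimate of lattice coefficients by the norm.\<close>
  define N where "N = \<lceil>2 * (R + 3)\<rceil>"
  define T where "T = (\<lambda>(k,u). \<omega>^k * u) ` ({..<6::nat} \<times> {W 1 0 0 0, W 1 0 1 (-1)})"
  define A where "A = (\<lambda>(p,m,n). p + lat m n) ` (T \<times> {-N..N} \<times> {-N..N})"
  have "finite A" unfolding A_def T_def by (intro finite_imageI finite_cartesian_product) auto
  moreover have "v \<in> A" if v: "v \<in> K_vertices" "v \<in> cball 0 R" for v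
  proof -
    obtain k u m n where k: "k < 6" "u \<in> {W 1 0 0 0, W 1 0 1 (-1)}" "v = \<omega>^k * u + lat m n"
      using vertex_form[OF v(1)] unfolding vform_def by blast
    have "norm u \<le> 3"
    proof -
      have "norm (W 1 0 0 0) = 1" by (simp add: W_def)
      moreover have "W 1 0 1 (-1) = 1 + (\<i> - \<i> * \<omega>)" by (simp add: W_def algebra_simps)
      moreover have "norm (1 + (\<i> - \<i> * \<omega>)) \<le> norm (1::complex) + (norm \<i> + norm (\<i> * \<omega>))"
        by (meson add_left_mono norm_triangle_ineq norm_triangle_ineq4 order_trans)
      ultimately show ?thesis using k(2) by (auto simp: norm_mult norm_omega)
    qed
    then have "norm (\<omega>^k * u) \<le> 3" by (simp add: norm_mult norm_power norm_omega)
    moreover have "lat m n = v - \<omega>^k * u" using k by simp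
    then have "norm (lat m n) \<le> norm v + norm (\<omega>^k * u)" by (metis norm_triangle_ineq4)
    ultimately have le: "norm (lat m n) \<le> R + 3" using v(2) by simp
    have "\<bar>real_of_int m\<bar> \<le> 2*(R+3)" "\<bar>real_of_int n\<bar> \<le> 2*(R+3)"
      using lat_norm_bounds(1)[where m=m and n=n] lat_norm_bounds(2)[where m=m and n=n] le norm_ge_zero[of "lat m n"] by argo+
    then have "m \<in> {-N..N}" "n \<in> {-N..N}" unfolding N_def by (auto simp: le_ceiling_iff abs_le_iff) linarith+
    then show ?thesis unfolding A_def T_def using k by force
  qed
  ultimately show ?thesis by (meson finite_subset Int_iff subsetI)
qed

subsection \<open>Elements of finite order\<close>

lemma lat_rot_powers:
  "\<omega>^0 * lat m n = lat m n" "\<omega>^1 * lat m n = lat (-n) (m+n)" "\<omega>^Suc 0 * lat m n = lat (-n) (m+n)"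
  "\<omega>^2 * lat m n = lat (-m-n) m" "\<omega>^3 * lat m n = lat (-m) (-n)"
  "\<omega>^4 * lat m n = lat n (-m-n)" "\<omega>^5 * lat m n = lat (m+n) (-m)"
  by (simp_all add: eval_nat_numeral mult.assoc lat_rot)

lemma omega_power_mod: "\<omega>^k = \<omega>^(k mod 6)"
proof -
  have "\<omega>^k = \<omega>^(6 * (k div 6) + k mod 6)" by simp
  also have "\<dots> = \<omega>^(k mod 6)" by (simp only: power_add power_mult omega_power6) simp
  finally show ?thesis .
qed

text \<open>The centre is half a lattice vector. If both coefficients are even it is a hexagon
  centre; otherwise it is the midpoint between two neighbouring hexagon centres, which is the
  midpoint of the edge between two triangles.\<close>

lemma half_turn_fixes:
  defines "f m n \<equiv> \<lambda>z. - z + lat m n"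
  shows "(\<exists>F\<in>K_faces. f m n ` F = F) \<or> (\<exists>E\<in>K_edges. f m n ` E = E)"
proof -
  have edge: "\<exists>E\<in>K_edges. f m n ` E = E" if "lat m n = \<omega>^k * lat 1 0 + (lat i j + lat i j)" for k i j
  proof -
    let ?s = "\<lambda>z. \<omega>^k * z + lat i j"
    let ?E = "{W 1 0 0 (-1), W 1 0 1 (-1)}"
    have "?E \<in> K_edges" by (rule edge0[of 7]) (simp_all add: protos_nth cyc_edges_3)
    then have 1: "?s ` ?E \<in> K_edges"
      using auto_map_affine unfolding auto_map_def cell_map_def by blast
    have "f m n (?s z) = ?s (lat 1 0 - z)" for z
      by (simp add: f_def that algebra_simps)
    moreover have "lat 1 0 - W 1 0 0 (-1) = W 1 0 1 (-1)" "lat 1 0 - W 1 0 1 (-1) = W 1 0 0 (-1)"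
      by (simp_all add: lat_def W_diff)
    ultimately have "f m n ` ?s ` ?E = ?s ` ?E" by (simp add: insert_commute)
    then show ?thesis using 1 by blast
  qed
  have face: "\<exists>F\<in>K_faces. f m n ` F = F" if "lat m n = lat i j + lat i j" for i j
  proof -
    let ?F = "(\<lambda>z. z + lat i j) ` hexagon"
    have "?F \<in> K_faces" unfolding hexagon_def by (rule proto_face) simp
    moreover have "uminus ` hexagon = hexagon"
      by (auto simp: hexagon_eq W_minus)
    then have "f m n ` ?F = ?F"
    proof -
      have "f m n ` ?F = (\<lambda>z. z + lat i j) ` (uminus ` hexagon)"
        by (simp add: image_image f_def that)
      then show ?thesis using \<open>uminus ` hexagon = hexagon\<close> by simp
    qed
    ultimately show ?thesis by blast
  qed
  \<comment> \<open>The nonzero classes modulo 2 are those of \<open>lat 1 0\<close> rotated by 0,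
    60 and 120 degrees; the last is \<open>lat (-1) 1\<close>, hence the minus sign.\<close>
  have "(\<exists>i j. m = 2*i \<and> n = 2*j) \<or> (\<exists>i j. m = 2*i+1 \<and> n = 2*j) \<or> (\<exists>i j. m = 2*i \<and> n = 2*j+1) \<or> (\<exists>i j. m = 2*i-1 \<and> n = 2*j+1)"
    by presburger
  then show ?thesis
  proof (elim disjE exE conjE)
    fix i j assume "m = 2*i" "n = 2*j"
    then show ?thesis using face[of i j] by (simp add: lat_add)
  next
    fix i j assume "m = 2*i+1" "n = 2*j"
    then show ?thesis using edge[of 0 i j] by (simp add: lat_add)
  next
    fix i j assume "m = 2*i" "n = 2*j+1"
    then show ?thesis using edge[of 1 i j] by (simp add: lat_rot lat_add)
  next
    fix i j assume "m = 2*i-1" "n = 2*j+1"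
    then show ?thesis using edge[of 2 i j] by (simp add: lat_rot_powers lat_add)
  qed
qed

text \<open>Multiplication by \<open>1 - \<omega>^2\<close> maps the lattice onto a sublattice of
  index 3, consisting of the vectors with coefficients 2u + v and v - u. The three cosets put the
  rotation centre at a hexagon centre, at the centre of a translate of tile 13, or at that of tile
  14.\<close>

lemma third_turn_fixes:
  defines "f m n \<equiv> \<lambda>z. \<omega>^2 * z + lat m n"
  shows "\<exists>F\<in>K_faces. f m n ` F = F"
proof -
  have face: "\<exists>F\<in>K_faces. f m n ` F = F"
    if "p < 15" "(\<lambda>z. \<omega>^2 * z + lat a b) ` set (protos ! p) = set (protos ! p)"
      "m = 2*u + v + a" "n = v - u + b" for u v a b p
  proof -
    let ?F = "(\<lambda>z. z + lat u v) ` set (protos ! p)"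
    have "f m n (z + lat u v) = (\<omega>^2 * z + lat a b) + lat u v" for z
      by (simp only: f_def distrib_left lat_rot_powers that(3,4) add.assoc lat_add) simp
    then have "f m n ` ?F = (\<lambda>z. z + lat u v) ` ((\<lambda>z. \<omega>^2 * z + lat a b) ` set (protos ! p))"
      by (simp add: image_image)
    then show ?thesis using that(1,2) proto_face by metis
  qed
  have "(\<exists>u v. m = 2*u+v \<and> n = v-u) \<or> (\<exists>u v. m = 2*u+v+1 \<and> n = v-u) \<or> (\<exists>u v. m = 2*u+v+1 \<and> n = v-u-1)"
    by presburger
  then show ?thesis
  proof (elim disjE exE conjE)
    fix u v assume "m = 2*u+v" "n = v-u"
    then show ?thesis
      by (intro face[of 0 0 0 u v]) (simp_all add: protos_nth W_rot_powers insert_commute)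
  next
    fix u v assume "m = 2*u+v+1" "n = v-u"
    then show ?thesis
      by (intro face[of 13 1 0 u v]) (simp_all add: protos_nth W_rot_powers W_plus_lat insert_commute)
  next
    fix u v assume "m = 2*u+v+1" "n = v-u-1"
    then show ?thesis
      by (intro face[of 14 1 "-1" u v]) (simp_all add: protos_nth W_rot_powers W_plus_lat insert_commute)
  qed
qed

text \<open>The hypothesis says that the map is an involution, so it is a reflection with no glide.
  For each of the six axis directions integer arithmetic finds a lattice point on the axis, and the
  hexagon about that point is invariant.\<close>

lemma mirror_fixes:
  assumes "\<omega>^k * cnj (lat m n) + lat m n = 0"
  shows "\<exists>F\<in>K_faces. (\<lambda>z. \<omega>^k * cnj z + lat m n) ` F = F"
proof -
  define r where "r = k mod 6"
  have k: "\<omega>^k = \<omega>^r" using omega_power_mod unfolding r_def .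
  have lat0: "lat a b = 0 \<longleftrightarrow> a = 0 \<and> b = 0" for a b using lat_eq_iff[of a b 0 0] by simp
  have "\<exists>u v. \<omega>^r * cnj (lat u v) + lat m n = lat u v"
  proof -
    have "r = 0 \<or> r = 1 \<or> r = 2 \<or> r = 3 \<or> r = 4 \<or> r = 5" unfolding r_def by presburger
    then show ?thesis
      using assms unfolding k
      by (elim disjE; simp only: lat_cnj lat_rot_powers lat_add lat0 lat_eq_iff; presburger)
  qed
  then obtain u v where uv: "\<omega>^k * cnj (lat u v) + lat m n = lat u v" unfolding k by blast
  let ?F = "(\<lambda>z. z + lat u v) ` hexagon"
  have "?F \<in> K_faces" unfolding hexagon_def by (rule proto_face) simp
  moreover have "(\<lambda>z. \<omega>^k * cnj z) ` hexagon = hexagon"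
  proof (rule endo_inj_surj)
    have "\<omega> \<noteq> 0" using norm_omega by auto
    then show "inj_on (\<lambda>z. \<omega>^k * cnj z) hexagon" by (simp add: inj_on_def)
    have "cnj z \<in> hexagon" if "z \<in> hexagon" for z
      using that by (auto simp: hexagon_eq W_cnj)
    then show "(\<lambda>z. \<omega>^k * cnj z) ` hexagon \<subseteq> hexagon" using hexagon_rot by auto
  qed (simp add: hexagon_def)
  moreover have "(\<omega>^k * cnj (z + lat u v)) + lat m n = \<omega>^k * cnj z + lat u v" for z
    using uv by (simp add: distrib_left add.assoc)
  then have "(\<lambda>z. \<omega>^k * cnj z + lat m n) ` ?F = (\<lambda>z. z + lat u v) ` ((\<lambda>z. \<omega>^k * cnj z) ` hexagon)"
    by (simp add: image_image)
  ultimately show ?thesis by metis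
qed

lemma edge_subset: "E \<in> K_edges \<Longrightarrow> E \<subseteq> K_vertices"
proof -
  assume "E \<in> K_edges"
  then obtain P where P: "P \<in> K_face_lists" "E \<in> cyc_edges P" unfolding K_edges_def by blast
  then obtain i where i: "i < length P" "E = {P ! i, P ! (Suc i mod length P)}" unfolding cyc_edges_def by blast
  from i(1) have "0 < length P" by (rule order.strict_trans1[OF le0])
  then have "Suc i mod length P < length P" by simp
  then have "E \<subseteq> set P" using i by simp
  moreover have "set P \<in> K_faces" using P(1) unfolding K_faces_def by blast
  ultimately show ?thesis using face_subset by blast
qed

lemma vertices_1_omega: "1 \<in> K_vertices" "\<omega> \<in> K_vertices"
proof -
  have "W 1 0 0 0 \<in> K_vertices" "W 0 1 0 0 \<in> K_vertices" using hexagon_vertices(1) by (auto simp: hexagon_eq)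
  then show "1 \<in> K_vertices" "\<omega> \<in> K_vertices" by (simp_all add: W_def)
qed

lemma rotation_id:
  assumes "\<And>v. v \<in> K_vertices \<Longrightarrow> c * v + l = v" shows "c = 1"
proof -
  have "c + l = 1" "c * \<omega> + l = \<omega>" using assms[of 1] assms[of \<omega>] vertices_1_omega by auto
  then have "(c + l) - (c * \<omega> + l) = 1 - \<omega>" by simp
  then have "c * (1 - \<omega>) = 1 - \<omega>" by (simp add: algebra_simps)
  moreover have "1 - \<omega> \<noteq> 0" by (simp add: \<omega>_def complex_eq_iff)
  ultimately show ?thesis by simp
qed

subsection \<open>Groups acting freely on the cells\<close>

lemma K_aut_auto_map: "K_aut g \<Longrightarrow> auto_map g"
proof -
  assume g: "K_aut g"
  then obtain h where "homeomorphism UNIV UNIV g h" unfolding K_aut_def by blast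
  then have "\<And>x. h (g x) = x" by (simp add: homeomorphism_def)
  then have "inj g" by (metis injI)
  then show ?thesis
    using g inj_on_subset[of g UNIV K_vertices] unfolding auto_map_def cell_map_def K_aut_def by auto
qed

lemma auto_map_dist:
  assumes "auto_map f" "v \<in> K_vertices" "w \<in> K_vertices"
  shows "dist (f v) (f w) = dist v w"
  using assms(1)
proof (cases rule: auto_map_cases)
  case (rotation k m n)
  then have "f v - f w = \<omega>^k * (v - w)" using assms by (simp add: algebra_simps)
  then show ?thesis by (simp add: dist_norm norm_mult norm_power norm_omega)
next
  case (reflection k m n)
  then have "f v - f w = \<omega>^k * cnj (v - w)" using assms by (simp add: algebra_simps)
  then show ?thesis
    unfolding dist_norm by (simp only: norm_mult norm_power norm_omega complex_mod_cnj) simp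
qed

locale free_group =
  fixes \<Gamma> :: "(complex \<Rightarrow> complex) set"
  assumes grp: "K_aut_subgroup \<Gamma>" and free: "acts_freely \<Gamma>"
begin

lemma aut: "g \<in> \<Gamma> \<Longrightarrow> K_aut g"
  and comp: "g \<in> \<Gamma> \<Longrightarrow> h \<in> \<Gamma> \<Longrightarrow> g \<circ> h \<in> \<Gamma>"
  and inver: "g \<in> \<Gamma> \<Longrightarrow> inv g \<in> \<Gamma>"
  and id_mem: "id \<in> \<Gamma>"
  using grp unfolding K_aut_subgroup_def by blast+

lemma homeo: "g \<in> \<Gamma> \<Longrightarrow> \<exists>h. homeomorphism UNIV UNIV g h"
  using aut unfolding K_aut_def by blast

lemma bij: "g \<in> \<Gamma> \<Longrightarrow> bij g"
proof -
  assume "g \<in> \<Gamma>"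
  then obtain h where "homeomorphism UNIV UNIV g h" using homeo by blast
  then have "\<And>x. h (g x) = x" "\<And>x. g (h x) = x" by (simp_all add: homeomorphism_def)
  then show ?thesis by (metis bijI')
qed

lemma cont: "g \<in> \<Gamma> \<Longrightarrow> continuous_on UNIV g"
  using homeo homeomorphism_cont1 by blast

lemma inv_apply: "g \<in> \<Gamma> \<Longrightarrow> inv g (g x) = x" "g \<in> \<Gamma> \<Longrightarrow> g (inv g x) = x"
  using bij by (simp_all add: bij_def surj_f_inv_f)

lemma auto: "g \<in> \<Gamma> \<Longrightarrow> auto_map g"
  using aut K_aut_auto_map by blast

lemma vertex: "g \<in> \<Gamma> \<Longrightarrow> v \<in> K_vertices \<Longrightarrow> g v \<in> K_vertices"
  using auto cell_map_vertex unfolding auto_map_def by blast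

lemma fixes_vertex: "g \<in> \<Gamma> \<Longrightarrow> v \<in> K_vertices \<Longrightarrow> g v = v \<Longrightarrow> g = id"
  and fixes_edge: "g \<in> \<Gamma> \<Longrightarrow> E \<in> K_edges \<Longrightarrow> g ` E = E \<Longrightarrow> g = id"
  and fixes_face: "g \<in> \<Gamma> \<Longrightarrow> F \<in> K_faces \<Longrightarrow> g ` F = F \<Longrightarrow> g = id"
  using free unfolding acts_freely_def by blast+

lemma eq_of_vertex: "g \<in> \<Gamma> \<Longrightarrow> h \<in> \<Gamma> \<Longrightarrow> v \<in> K_vertices \<Longrightarrow> g v = h v \<Longrightarrow> g = h"
proof -
  assume a: "g \<in> \<Gamma>" "h \<in> \<Gamma>" "v \<in> K_vertices" "g v = h v"
  then have "inv h \<circ> g = id"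
    by (intro fixes_vertex[of _ v] comp inver) (simp_all add: inv_apply)
  show "g = h"
  proof
    fix x
    have "h ((inv h \<circ> g) x) = h x" using \<open>inv h \<circ> g = id\<close> by simp
    then show "g x = h x" using a(2) by (simp add: inv_apply)
  qed
qed

text \<open>Compare y with a corner w of a face whose hull contains y: on vertices g is an isometry,
  and g maps the hull to the hull of another face, whose diameter is bounded as well.\<close>

lemma displacement:
  obtains D where "\<And>g v y. g \<in> \<Gamma> \<Longrightarrow> v \<in> K_vertices \<Longrightarrow> dist (g v) (g y) \<le> dist v y + D"
proof -
  obtain D where D: "\<And>F u v. F \<in> K_faces \<Longrightarrow> u \<in> convex hull F \<Longrightarrow> v \<in> convex hull F \<Longrightarrow> dist u v \<le> D"
    using face_hulls_bounded by metis
  show ?thesis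
  proof
    fix g v y assume g: "g \<in> \<Gamma>" and v: "v \<in> K_vertices"
    obtain F where F: "F \<in> K_faces" "y \<in> convex hull F" using faces_cover unfolding covered_def by blast
    then have "F \<noteq> {}" by auto
    then obtain w where w: "w \<in> F" by blast
    then have wV: "w \<in> K_vertices" using F(1) face_subset by blast
    have gF: "g ` F \<in> K_faces" "g ` (convex hull F) = convex hull (g ` F)"
      using aut[OF g] F(1) unfolding K_aut_def by blast+
    have "g y \<in> convex hull (g ` F)" unfolding gF(2)[symmetric] using F(2) by (rule imageI)
    moreover have "g w \<in> convex hull (g ` F)" using w by (simp add: hull_inc)
    ultimately have 1: "dist (g w) (g y) \<le> D" using D[OF gF(1)] by blast
    have 2: "dist w y \<le> D" using D[OF F(1) _ F(2)] w by (simp add: hull_inc)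
    have "dist (g v) (g y) \<le> dist (g v) (g w) + dist (g w) (g y)" by (rule dist_triangle)
    also have "dist (g v) (g w) = dist v w" by (rule auto_map_dist[OF auto[OF g] v wV])
    also have "dist v w \<le> dist v y + dist w y" by (rule dist_triangle2)
    finally show "dist (g v) (g y) \<le> dist v y + (D + D)" using 1 2 by linarith
  qed
qed

text \<open>An element is determined by its value at the vertex 1, and bounded displacement confines
  that value to a disc, which contains finitely many vertices.\<close>

lemma finite_return: "finite {g\<in>\<Gamma>. \<exists>y. norm y \<le> R \<and> norm (g y) \<le> R}"
proof -
  obtain D where D: "\<And>g v y. g \<in> \<Gamma> \<Longrightarrow> v \<in> K_vertices \<Longrightarrow> dist (g v) (g y) \<le> dist v y + D"
    using displacement by metis
  let ?A = "{g\<in>\<Gamma>. \<exists>y. norm y \<le> R \<and> norm (g y) \<le> R}"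
  have "(\<lambda>g. g 1) ` ?A \<subseteq> K_vertices \<inter> cball 0 (1 + R + D + R)"
  proof
    fix z assume "z \<in> (\<lambda>g. g 1) ` ?A"
    then obtain g y where g: "g \<in> \<Gamma>" "norm y \<le> R" "norm (g y) \<le> R" "z = g 1" by blast
    have "norm z \<le> norm (g y) + dist (g 1) (g y)"
      unfolding g(4) dist_norm using norm_triangle_sub by blast
    moreover have "dist (g 1) (g y) \<le> dist 1 y + D" using D g(1) vertices_1_omega(1) by blast
    moreover have "dist 1 y \<le> 1 + norm y" unfolding dist_norm using norm_triangle_ineq4[of 1 y] by simp
    moreover have "z \<in> K_vertices" using g vertex vertices_1_omega(1) by blast
    ultimately show "z \<in> K_vertices \<inter> cball 0 (1 + R + D + R)" using g(2,3) by simp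
  qed
  then have "finite ((\<lambda>g. g 1) ` ?A)" using finite_vertices_cball finite_subset by blast
  moreover have "inj_on (\<lambda>g. g 1) ?A"
    using eq_of_vertex vertices_1_omega(1) by (intro inj_onI) blast
  ultimately show ?thesis by (rule finite_imageD)
qed

section \<open>Exclusion of rotations\<close>

lemma no_half_turn:
  assumes "g \<in> \<Gamma>" "\<And>v. v \<in> K_vertices \<Longrightarrow> g v = - v + lat m n" shows False
proof -
  have im: "g ` A = (\<lambda>z. - z + lat m n) ` A" if "A \<subseteq> K_vertices" for A
    using that assms(2) by (intro image_cong) auto
  have "g = id"
    using half_turn_fixes[of m n] fixes_face[OF assms(1)] fixes_edge[OF assms(1)] im face_subset edge_subset
    by metis
  then have "(-1::complex) = 1" using assms(2) by (intro rotation_id[of _ "lat m n"]) auto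
  then show False by simp
qed

lemma no_third_turn:
  assumes "g \<in> \<Gamma>" "\<And>v. v \<in> K_vertices \<Longrightarrow> g v = \<omega>^2 * v + lat m n" shows False
proof -
  have im: "g ` A = (\<lambda>z. \<omega>^2 * z + lat m n) ` A" if "A \<subseteq> K_vertices" for A
    using that assms(2) by (intro image_cong) auto
  have "g = id"
    using third_turn_fixes[of m n] fixes_face[OF assms(1)] im face_subset by metis
  then have "\<omega>^2 = 1" using assms(2) by (intro rotation_id[of _ "lat m n"]) auto
  then have "\<omega> - 1 = 1" using omega_sq by (simp add: power2_eq_square)
  then show False by (simp add: \<omega>_def complex_eq_iff)
qed

text \<open>Some power of a nontrivial rotation is a half-turn or a turn by 120 degrees: the cube
  for exponents 1 and 5, the square for 4, the element itself for 2 and 3.\<close>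

lemma rotation_trivial:
  assumes g: "g \<in> \<Gamma>" "\<And>v. v \<in> K_vertices \<Longrightarrow> g v = \<omega>^k * v + lat m n"
  shows "\<omega>^k = 1"
proof (rule ccontr)
  assume ne: "\<omega>^k \<noteq> 1"
  define r where "r = k mod 6"
  have k: "\<omega>^k = \<omega>^r" using omega_power_mod unfolding r_def .
  have g1: "g v = \<omega>^r * v + lat m n" if "v \<in> K_vertices" for v using g(2) that k by simp
  have g2: "(g \<circ> g) v = \<omega>^r * (\<omega>^r * v) + (\<omega>^r * lat m n + lat m n)" if "v \<in> K_vertices" for v
    using that g1 vertex[OF g(1)] by (simp add: distrib_left add.assoc)
  have g3: "(g \<circ> (g \<circ> g)) v = \<omega>^r * (\<omega>^r * (\<omega>^r * v)) + (\<omega>^r * (\<omega>^r * lat m n + lat m n) + lat m n)"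
    if "v \<in> K_vertices" for v
    using g1[OF vertex[OF g(1) vertex[OF g(1) that]]] g2[OF that] by (simp add: distrib_left)
  have r0: "r \<noteq> 0" using ne k by (metis power_0)
  obtain a b where ab: "\<omega>^r * lat m n + lat m n = lat a b"
    using lat_power_rot lat_add by metis
  obtain c d where cd: "\<omega>^r * lat a b + lat m n = lat c d"
    using lat_power_rot lat_add by metis
  note g2 = g2[unfolded ab] and g3 = g3[unfolded ab cd]
  have "r = 1 \<or> r = 2 \<or> r = 3 \<or> r = 4 \<or> r = 5" using r0 unfolding r_def by presburger
  then show False
  proof (elim disjE)
    assume r: "r = 1"
    have "\<omega> * (\<omega> * (\<omega> * v)) = - v" for v
      using omega_power3 by (simp add: power3_eq_cube mult.assoc[symmetric])
    then have "(g \<circ> (g \<circ> g)) v = - v + lat c d" if "v \<in> K_vertices" for v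
      using g3[OF that] unfolding r power_one_right by simp
    then show False by (rule no_half_turn[OF comp[OF g(1) comp[OF g(1) g(1)]]])
  next
    assume r: "r = 2"
    then show False using no_third_turn[OF g(1)] g1 by blast
  next
    assume r: "r = 3"
    then have "g v = - v + lat m n" if "v \<in> K_vertices" for v
      using g1[OF that] by (simp add: omega_power3)
    then show False by (rule no_half_turn[OF g(1)])
  next
    assume r: "r = 4"
    have "\<omega>^4 * (\<omega>^4 * v) = \<omega>^2 * v" for v
      using omega_power_mod[of 8] by (simp add: mult.assoc[symmetric] power_add[symmetric])
    then have "(g \<circ> g) v = \<omega>^2 * v + lat a b" if "v \<in> K_vertices" for v
      using g2[OF that] unfolding r by simp
    then show False by (rule no_third_turn[OF comp[OF g(1) g(1)]])
  next
    assume r: "r = 5"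
    have "\<omega>^5 * (\<omega>^5 * (\<omega>^5 * v)) = - v" for v
      using omega_power_mod[of 15] omega_power3 by (simp add: mult.assoc[symmetric] power_add[symmetric])
    then have "(g \<circ> (g \<circ> g)) v = - v + lat c d" if "v \<in> K_vertices" for v
      using g3[OF that] unfolding r by simp
    then show False by (rule no_half_turn[OF comp[OF g(1) comp[OF g(1) g(1)]]])
  qed
qed

lemma cases:
  assumes g: "g \<in> \<Gamma>"
  obtains (translation) m n where "\<And>v. v \<in> K_vertices \<Longrightarrow> g v = v + lat m n"
    | (reflection) k m n where "\<And>v. v \<in> K_vertices \<Longrightarrow> g v = \<omega>^k * cnj v + lat m n"
  using auto[OF g]
proof (cases rule: auto_map_cases)
  case (rotation k m n)
  then have "\<omega>^k = 1" using rotation_trivial g by blast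
  then show ?thesis using rotation translation by simp
next
  case (reflection k m n)
  then show ?thesis using that(2) by blast
qed

section \<open>Absence of torsion and proper discontinuity\<close>

lemma funpow_mem: "g \<in> \<Gamma> \<Longrightarrow> g ^^ n \<in> \<Gamma>"
  by (induction n) (simp_all add: comp id_mem id_def[symmetric])

lemma torsion_translation:
  assumes g: "g \<in> \<Gamma>" "g ^^ N = id" "N > 0" and tr: "\<And>v. v \<in> K_vertices \<Longrightarrow> g v = v + lat m n"
  shows "g = id"
proof -
  have V: "1 \<in> K_vertices" by (rule vertices_1_omega)
  have "(g ^^ i) 1 = 1 + of_nat i * lat m n" for i
  proof (induction i)
    case (Suc i)
    have "(g ^^ i) 1 \<in> K_vertices" using funpow_mem[OF g(1)] vertex V by blast
    then show ?case using Suc tr by (simp add: algebra_simps)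
  qed simp
  from this[of N] have "of_nat N * lat m n = 0" using g(2) by simp
  then have "lat m n = 0" using g(3) by simp
  then show ?thesis using tr[OF V] by (intro fixes_vertex[OF g(1) V]) simp
qed

text \<open>The square of a reflection of finite order is a translation of finite order, hence the
  identity. The reflection then has no glide part and preserves a face.\<close>

lemma torsion_free:
  assumes g: "g \<in> \<Gamma>" "g ^^ N = id" "N > 0" shows "g = id"
  using g(1)
proof (cases rule: cases)
  case (translation m n)
  then show ?thesis using torsion_translation g by blast
next
  case (reflection k m n)
  have c: "cnj \<omega> ^ k * \<omega>^k = 1" using omega_mult_cnj by (simp add: mult.commute flip: power_mult_distrib)
  obtain a b where ab: "\<omega>^k * cnj (lat m n) + lat m n = lat a b"
    using lat_cnj lat_power_rot lat_add by metis
  have gg: "(g \<circ> g) v = v + lat a b" if "v \<in> K_vertices" for v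
  proof -
    have "(g \<circ> g) v = (\<omega>^k * cnj \<omega>^k) * v + (\<omega>^k * cnj (lat m n) + lat m n)"
      using that reflection vertex[OF g(1)] by (simp add: algebra_simps)
    then show ?thesis using c ab by (simp add: mult.commute)
  qed
  have "(g \<circ> g) ^^ N = id"
  proof -
    have "(g \<circ> g) ^^ N = (g ^^ 2) ^^ N" by (simp add: numeral_2_eq_2)
    also have "\<dots> = (g ^^ N) ^^ 2" by (simp only: funpow_mult mult.commute)
    finally show ?thesis using g(2) by simp
  qed
  then have "g \<circ> g = id" using torsion_translation comp g gg by metis
  then have "lat a b = 0" using gg[OF vertices_1_omega(1)] by simp
  then obtain F where F: "F \<in> K_faces" "(\<lambda>z. \<omega>^k * cnj z + lat m n) ` F = F"
    using mirror_fixes ab by metis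
  have "g ` F = (\<lambda>z. \<omega>^k * cnj z + lat m n) ` F"
    using face_subset[OF F(1)] reflection by (intro image_cong) auto
  then show ?thesis using fixes_face[OF g(1) F(1)] F(2) by simp
qed

text \<open>All powers of g fix x and so lie in one finite return set; two of them coincide, and g
  has finite order.\<close>

lemma free_everywhere:
  assumes g: "g \<in> \<Gamma>" "g x = x" shows "g = id"
proof -
  have fixed: "(g ^^ i) x = x" for i using g(2) by (induction i) auto
  have "range (\<lambda>i. g ^^ i) \<subseteq> {h\<in>\<Gamma>. \<exists>y. norm y \<le> norm x \<and> norm (h y) \<le> norm x}"
    using fixed funpow_mem[OF g(1)] by auto
  then have "finite (range (\<lambda>i. g ^^ i))" using finite_return finite_subset by blast
  then have "\<not> inj (\<lambda>i. g ^^ i)" using finite_imageD infinite_UNIV_nat by blast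
  then obtain i j where ij: "g ^^ i = g ^^ j" "i < j" unfolding inj_def by (metis linorder_neqE_nat)
  have "g ^^ (j - i) = id"
  proof (rule eq_of_vertex[OF funpow_mem[OF g(1)] id_mem])
    have "1 = inv (g ^^ i) ((g ^^ i) 1)" using inv_apply funpow_mem g(1) by metis
    show "inv (g ^^ i) 1 \<in> K_vertices" using vertex[OF inver[OF funpow_mem[OF g(1)]]] vertices_1_omega(1) .
    have "(g ^^ (j - i)) ((g ^^ i) z) = (g ^^ j) z" for z
      using ij(2) by (metis comp_apply funpow_add less_imp_le_nat ordered_cancel_comm_monoid_diff_class.diff_add)
    moreover have "(g ^^ i) ((g ^^ (j - i)) z) = (g ^^ j) z" for z
      using ij(2) by (metis comp_apply funpow_add less_imp_le_nat ordered_cancel_comm_monoid_diff_class.add_diff_inverse)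
    ultimately have "(g ^^ i) ((g ^^ (j - i)) z) = (g ^^ i) z" for z using ij(1) by simp
    then show "(g ^^ (j - i)) (inv (g ^^ i) 1) = id (inv (g ^^ i) 1)"
      using inv_apply(1)[OF funpow_mem[OF g(1)]] by (metis id_apply)
  qed
  then show ?thesis using torsion_free g(1) ij(2) by simp
qed

text \<open>Only finitely many elements can return to the unit ball about x. Each nontrivial one
  moves x, so a smaller neighbourhood separates x from its image, and finitely many such
  neighbourhoods are intersected.\<close>

lemma properly_discontinuous:
  "\<exists>U. open U \<and> x \<in> U \<and> (\<forall>g\<in>\<Gamma>. g ` U \<inter> U \<noteq> {} \<longrightarrow> g = id)"
proof -
  define R where "R = norm x + 1"
  define A where "A = {g\<in>\<Gamma>. \<exists>y. norm y \<le> R \<and> norm (g y) \<le> R} - {id}"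
  have finA: "finite A" unfolding A_def using finite_return by simp
  have "\<exists>U. open U \<and> x \<in> U \<and> g ` U \<inter> U = {}" if "g \<in> A" for g
  proof -
    have g: "g \<in> \<Gamma>" "g \<noteq> id" using that by (auto simp: A_def)
    then have "g x \<noteq> x" using free_everywhere by blast
    then obtain V W where VW: "open V" "open W" "g x \<in> V" "x \<in> W" "V \<inter> W = {}"
      by (metis hausdorff)
    have "open (g -` V)" using cont[OF g(1)] VW(1) by (simp add: continuous_on_open_vimage)
    then show ?thesis using VW by (intro exI[of _ "W \<inter> g -` V"]) auto
  qed
  then obtain U where U: "\<And>g. g \<in> A \<Longrightarrow> open (U g) \<and> x \<in> U g \<and> g ` U g \<inter> U g = {}" by metis
  define T where "T = ball x 1 \<inter> (\<Inter>g\<in>A. U g)"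
  have "open T" unfolding T_def using finA U by (intro open_Int open_INT) auto
  moreover have "x \<in> T" unfolding T_def using U by auto
  moreover have "g = id" if g: "g \<in> \<Gamma>" "g ` T \<inter> T \<noteq> {}" for g
  proof (rule ccontr)
    assume "g \<noteq> id"
    obtain y where y: "y \<in> T" "g y \<in> T" using g(2) by blast
    have "norm z \<le> R" if "z \<in> T" for z
      using that norm_triangle_sub[of z x] unfolding T_def R_def by (simp add: dist_norm norm_minus_commute)
    then have "g \<in> A" using y g \<open>g \<noteq> id\<close> unfolding A_def by blast
    then show False using U[of g] y unfolding T_def by blast
  qed
  ultimately show ?thesis by blast
qed

end

subsection \<open>Torus quotients\<close>

locale torus_group = free_group +
  assumes torus: "quotient_is_torus \<Gamma>"
begin

lemma torus_covering:
  obtains q :: "complex \<Rightarrow> complex \<times> complex" where "covering_space UNIV q (sphere 0 1 \<times> sphere 0 1)"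
    "\<And>x y. q x = q y \<longleftrightarrow> (\<exists>g\<in>\<Gamma>. g x = y)"
    "\<And>U. open U \<Longrightarrow> openin (top_of_set (sphere 0 1 \<times> sphere 0 1)) (q ` U)"
proof -
  obtain q :: "complex \<Rightarrow> complex \<times> complex"
    where q: "quotient_map euclidean torus_top q" "\<forall>x y. q x = q y \<longleftrightarrow> (\<exists>g\<in>\<Gamma>. g x = y)"
    using torus unfolding quotient_is_torus_def by blast
  have top: "torus_top = top_of_set (sphere 0 1 \<times> sphere 0 1)"
    unfolding torus_top_def prod_topology_subtopology_eu by simp
  have q': "quotient_map euclidean (top_of_set (sphere 0 1 \<times> sphere 0 1)) q" using q(1) unfolding top .
  note orb = orbit_map_covering_space[where \<Gamma>=\<Gamma>, OF q' q(2)[rule_format]]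
  show ?thesis
  proof (rule that)
    show "covering_space UNIV q (sphere 0 1 \<times> sphere 0 1)"
      by (rule orb(1)) (fact homeo comp inver properly_discontinuous)+
    show "q x = q y \<longleftrightarrow> (\<exists>g\<in>\<Gamma>. g x = y)" for x y using q(2) by blast
    show "openin (top_of_set (sphere 0 1 \<times> sphere 0 1)) (q ` U)" if "open U" for U
      by (rule orb(2)[OF _ _ _ _ that]) (fact homeo comp inver properly_discontinuous)+
  qed
qed

lemma commute: "g \<in> \<Gamma> \<Longrightarrow> h \<in> \<Gamma> \<Longrightarrow> g \<circ> h = h \<circ> g"
proof -
  assume gh: "g \<in> \<Gamma>" "h \<in> \<Gamma>"
  obtain q :: "complex \<Rightarrow> complex \<times> complex" where q: "covering_space UNIV q (sphere 0 1 \<times> sphere 0 1)"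
    "\<And>x y. q x = q y \<longleftrightarrow> (\<exists>g\<in>\<Gamma>. g x = y)"
    using torus_covering by metis
  show ?thesis
    by (rule torus_deck_commute[OF q cont bij_is_inj[OF bij] gh])
qed

text \<open>The images of the balls about 0 form an open cover of the compact torus, and the largest
  radius in a finite subcover serves as R.\<close>

lemma cocompact: obtains R where "\<And>x. \<exists>g\<in>\<Gamma>. norm (g x) \<le> R"
proof -
  let ?T = "sphere 0 1 \<times> sphere 0 1 :: (complex \<times> complex) set"
  obtain q :: "complex \<Rightarrow> complex \<times> complex" where q: "covering_space UNIV q ?T"
    "\<And>x y. q x = q y \<longleftrightarrow> (\<exists>g\<in>\<Gamma>. g x = y)"
    "\<And>U. open U \<Longrightarrow> openin (top_of_set ?T) (q ` U)"
    by (rule torus_covering, rule that)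
  have im: "q ` UNIV = ?T" using q(1) unfolding covering_space_def by blast
  have "compact ?T" by (intro compact_Times compact_sphere)
  moreover have "\<forall>c\<in>range (\<lambda>n. q ` ball 0 (real n)). openin (top_of_set ?T) c" using q(3) by auto
  moreover have "?T \<subseteq> \<Union> (range (\<lambda>n. q ` ball 0 (real n)))"
  proof
    fix y assume "y \<in> ?T"
    then obtain x where x: "y = q x" using im by blast
    obtain n :: nat where "norm x < real n" using reals_Archimedean2 by blast
    then have "x \<in> ball 0 (real n)" by simp
    then show "y \<in> \<Union> (range (\<lambda>n. q ` ball 0 (real n)))" unfolding x by blast
  qed
  ultimately obtain D where D: "D \<subseteq> range (\<lambda>n. q ` ball 0 (real n))" "finite D" "?T \<subseteq> \<Union>D"
    unfolding compact_eq_openin_cover by meson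
  then obtain N where N: "finite N" "D = (\<lambda>n. q ` ball 0 (real n)) ` N"
    by (meson finite_subset_image)
  show ?thesis
  proof
    fix x
    have "q x \<in> \<Union>D" using D(3) im by blast
    then obtain n y where n: "n \<in> N" "q x = q y" "norm y < real n" unfolding N(2) by auto
    then obtain g where g: "g \<in> \<Gamma>" "g x = y" using q(2) by metis
    have "norm (g x) \<le> real (Max N)" using n g(2) Max_ge[OF N(1) n(1)] by simp
    then show "\<exists>g\<in>\<Gamma>. norm (g x) \<le> real (Max N)" using g(1) by blast
  qed
qed

text \<open>A glide reflection g would commute with the whole group, so the distance to its axis would
  be bounded on the vertices by cocompactness. The function p measures this distance.\<close>
lemma no_reflection:
  assumes g: "g \<in> \<Gamma>" "\<And>v. v \<in> K_vertices \<Longrightarrow> g v = \<omega>^k * cnj v + lat m n"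
  shows False
proof -
  define J where "J = (\<lambda>z. \<omega>^k * cnj z)"
  define l where "l = lat m n"
  define p where "p = (\<lambda>z. z - J z)"
  have Jadd: "J (x + y) = J x + J y" for x y by (simp add: J_def algebra_simps)
  have cc: "\<omega>^j * cnj \<omega>^j = 1" for j
    using omega_mult_cnj by (simp flip: power_mult_distrib)
  have JJ: "J (J z) = z" for z
    using cc[of k] by (simp add: J_def mult.assoc[symmetric])
  have normJ: "norm (J z) = norm z" for z by (simp add: J_def norm_mult norm_power norm_omega)
  have gJ: "g v = J v + l" if "v \<in> K_vertices" for v using g(2)[OF that] by (simp add: J_def l_def)
  \<comment> \<open>A translation that commutes with g is parallel to the axis and leaves p
    unchanged. A reflection that commutes with g has the same axis, and p changes sign up to a
    constant.\<close>
  have ph: "p (h v) = p v \<or> p (h v) = (l - J l) - p v" if h: "h \<in> \<Gamma>" and v: "v \<in> K_vertices" for h v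
    using h
  proof (cases rule: cases)
    case (translation a b)
    have "g (h v) = h (g v)" using commute[OF g(1) h] by (metis comp_apply)
    then have "J (v + lat a b) + l = J v + l + lat a b"
      using translation gJ v vertex[OF g(1) v] vertex[OF h v] by metis
    then have "J (lat a b) = lat a b" by (simp add: Jadd)
    then show ?thesis using translation[OF v] by (simp add: p_def Jadd)
  next
    case (reflection j a b)
    define l' where "l' = lat a b"
    have hv: "h w = \<omega>^j * cnj w + l'" if "w \<in> K_vertices" for w using reflection[OF that] by (simp add: l'_def)
    have cnj5: "cnj \<omega> = \<omega>^5"
    proof -
      have "\<omega>^5 = \<omega>^3 * (\<omega> * \<omega>)" by (simp add: eval_nat_numeral)
      then show ?thesis by (simp add: omega_power3 omega_sq omega_cnj)
    qed
    have gh: "(g \<circ> h) w = \<omega>^(k + 5*j) * w + (J l' + l)" if "w \<in> K_vertices" for w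
    proof -
      have "(g \<circ> h) w = J (\<omega>^j * cnj w + l') + l" using gJ[OF vertex[OF h that]] hv[OF that] by simp
      also have "\<dots> = \<omega>^k * cnj \<omega>^j * w + (J l' + l)" unfolding Jadd by (simp add: J_def)
      finally show ?thesis by (simp add: cnj5 power_add power_mult)
    qed
    obtain c d where cd: "J l' + l = lat c d"
      unfolding J_def l'_def l_def using lat_cnj lat_power_rot lat_add by metis
    \<comment> \<open>A product of two reflections preserves orientation, so in this group it is a
      translation; both reflections therefore have the linear part J.\<close>
    have "\<omega>^(k + 5*j) = 1" using rotation_trivial[OF comp[OF g(1) h]] gh unfolding cd by blast
    then have "\<omega>^k * cnj \<omega>^j = 1" by (simp add: cnj5 power_add power_mult)
    then have "\<omega>^j = \<omega>^j * (\<omega>^k * cnj \<omega>^j)" by simp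
    also have "\<dots> = \<omega>^k" using cc[of j] by (simp add: mult.left_commute)
    finally have hJ: "h w = J w + l'" if "w \<in> K_vertices" for w using hv[OF that] by (simp add: J_def)
    have "g (h v) = h (g v)" using commute[OF g(1) h] by (metis comp_apply)
    then have "J (J v + l') + l = J (J v + l) + l'"
      using gJ[OF vertex[OF h v]] hJ[OF vertex[OF g(1) v]] gJ[OF v] hJ[OF v] by simp
    then have "l' - J l' = l - J l" by (simp add: Jadd JJ algebra_simps)
    moreover have "p (h v) = (l' - J l') - p v" using hJ[OF v] by (simp add: p_def Jadd JJ)
    ultimately show ?thesis by simp
  qed
  obtain R where R: "\<And>x. \<exists>g\<in>\<Gamma>. norm (g x) \<le> R" using cocompact by metis
  have bound: "norm (p v) \<le> 2*R + norm (l - J l)" if v: "v \<in> K_vertices" for v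
  proof -
    obtain h where h: "h \<in> \<Gamma>" "norm (h v) \<le> R" using R by blast
    have "norm (p (h v)) \<le> norm (h v) + norm (J (h v))" unfolding p_def by (rule norm_triangle_ineq4)
    then have 1: "norm (p (h v)) \<le> 2 * R" using h(2) by (simp add: normJ)
    from ph[OF h(1) v] show ?thesis
    proof
      assume "p (h v) = p v"
      then have "norm (p v) \<le> 2*R + 0" using 1 by simp
      also have "\<dots> \<le> 2*R + norm (l - J l)" by (intro add_left_mono norm_ge_zero)
      finally show ?thesis .
    next
      assume "p (h v) = (l - J l) - p v"
      then have "p v = (l - J l) - p (h v)" by simp
      then have "norm (p v) \<le> norm (l - J l) + norm (p (h v))" by (metis norm_triangle_ineq4)
      then show ?thesis using 1 by simp
    qed
  qed
  have lin: "p (of_nat N * z) = of_nat N * p z" for N z by (simp add: p_def J_def algebra_simps)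
  have padd: "p (x + y) = p x + p y" for x y by (simp add: p_def Jadd)
  \<comment> \<open>J reverses orientation, so it cannot fix both generators of the lattice.
    Vertices moved by multiples of a generator that it does not fix make p unbounded.\<close>
  obtain a b where ab: "p (lat a b) \<noteq> 0"
  proof (cases "p (lat 1 0) = 0")
    case True
    have L: "lat 1 0 = of_real ell" by (simp add: lat_B B_def)
    have "\<omega>^k = 1" using True ell_pos(1) unfolding L p_def J_def by simp
    then have "p (lat 0 1) = of_real ell * (\<omega> - cnj \<omega>)" by (simp add: p_def J_def lat_B B_def algebra_simps)
    moreover have "\<omega> - cnj \<omega> \<noteq> 0" by (simp add: \<omega>_def complex_eq_iff)
    ultimately have "p (lat 0 1) \<noteq> 0" using ell_pos(1) by simp
    then show ?thesis using that by blast
  qed (use that in blast)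
  have "norm (of_nat N * p (lat a b)) \<le> 2*R + norm (l - J l) + norm (p 1)" for N
  proof -
    have eq: "of_nat N * lat a b = lat (int N * a) (int N * b)"
      by (simp add: lat_B B_def algebra_simps)
    have "1 + of_nat N * lat a b \<in> K_vertices"
      unfolding eq by (rule cell_map_vertex[OF cell_map_translation vertices_1_omega(1)])
    from bound[OF this] have "norm (p 1 + of_nat N * p (lat a b)) \<le> 2*R + norm (l - J l)" by (simp add: padd lin)
    moreover have "norm (of_nat N * p (lat a b)) \<le> norm (p 1 + of_nat N * p (lat a b)) + norm (p 1)"
      using norm_triangle_ineq4[of "p 1 + of_nat N * p (lat a b)" "p 1"] by simp
    ultimately show ?thesis by linarith
  qed
  then have b: "real N * norm (p (lat a b)) \<le> 2*R + norm (l - J l) + norm (p 1)" for N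
    by (simp add: norm_mult)
  obtain N where "2*R + norm (l - J l) + norm (p 1) < real N * norm (p (lat a b))"
    using reals_Archimedean3[of "norm (p (lat a b))"] ab by auto
  then show False using b[of N] by simp
qed

lemma all_translations: "g \<in> \<Gamma> \<Longrightarrow> \<exists>m n. \<forall>v\<in>K_vertices. g v = v + lat m n"
proof -
  assume g: "g \<in> \<Gamma>"
  show ?thesis
    using g
  proof (cases rule: cases)
    case (translation m n)
    then show ?thesis by blast
  next
    case (reflection k m n)
    then show ?thesis using no_reflection[OF g] by blast
  qed
qed

section \<open>Symmetries of the tiling that descend to the quotient\<close>

definition syms :: "(complex \<Rightarrow> complex) set" where
  "syms = {s. \<exists>c m n. (c = 1 \<or> c = -1) \<and> s = (\<lambda>z. c * z + lat m n)}"

lemma syms_cell_map: "s \<in> syms \<Longrightarrow> cell_map s"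
proof -
  assume "s \<in> syms"
  then obtain c m n where c: "c = 1 \<or> c = -1" and s: "s = (\<lambda>z. c * z + lat m n)" unfolding syms_def by blast
  have "\<exists>k. c = \<omega>^k"
    using c omega_power3 by (metis power_0)
  then show ?thesis using auto_map_affine unfolding s auto_map_def by blast
qed

lemma syms_inverse: 
  assumes "s \<in> syms" obtains t where "t \<in> syms" "\<And>z. s (t z) = z" "\<And>z. t (s z) = z"
proof -
  obtain c m n where c: "c = 1 \<or> c = -1" and s: "s = (\<lambda>z. c * z + lat m n)" using assms unfolding syms_def by blast
  obtain m' n' where mn: "- (c * lat m n) = lat m' n'" using c lat_minus by (metis minus_mult_minus mult_1 minus_minus)
  show ?thesis
  proof
    show "(\<lambda>z. c * z + lat m' n') \<in> syms" unfolding syms_def using c by blast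
  qed (use c in \<open>auto simp: s mn[symmetric] algebra_simps\<close>)
qed

text \<open>On vertices every g is a translation: a translation s commutes with it, while a
  half-turn s gives \<open>s (g v) = inv g (s v)\<close>, which is again in the orbit of
  \<open>s v\<close>.\<close>

lemma orb_sym_subset:
  assumes s: "s \<in> syms" and v: "v \<in> K_vertices"
  shows "s ` orb \<Gamma> v \<subseteq> orb \<Gamma> (s v)"
proof
  fix z assume "z \<in> s ` orb \<Gamma> v"
  then obtain g where g: "g \<in> \<Gamma>" "z = s (g v)" unfolding orb_def by blast
  obtain c m n where c: "c = 1 \<or> c = -1" and s': "s = (\<lambda>z. c * z + lat m n)" using s unfolding syms_def by blast
  obtain a b where ab: "\<And>v. v \<in> K_vertices \<Longrightarrow> g v = v + lat a b" using all_translations g(1) by metis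
  have sv: "s v \<in> K_vertices" using cell_map_vertex syms_cell_map s v by blast
  from c show "z \<in> orb \<Gamma> (s v)"
  proof
    assume "c = 1"
    then have "z = g (s v)" using ab[OF sv] ab[OF v] by (simp add: g(2) s')
    then show ?thesis using g(1) unfolding orb_def by blast
  next
    assume c: "c = -1"
    have "inv g (s v) + lat a b = g (inv g (s v))" using ab vertex[OF inver[OF g(1)] sv] by metis
    also have "\<dots> = s v" using inv_apply g(1) by blast
    finally have "z = inv g (s v)" using ab[OF v] by (simp add: g(2) s' c algebra_simps)
    then show ?thesis using inver[OF g(1)] unfolding orb_def by blast
  qed
qed

lemma orb_sym:
  assumes s: "s \<in> syms" and v: "v \<in> K_vertices"
  shows "s ` orb \<Gamma> v = orb \<Gamma> (s v)"
proof
  obtain t where t: "t \<in> syms" "\<And>z. s (t z) = z" "\<And>z. t (s z) = z" using syms_inverse[OF s] by metis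
  have sv: "s v \<in> K_vertices" using cell_map_vertex syms_cell_map s v by blast
  have "t ` orb \<Gamma> (s v) \<subseteq> orb \<Gamma> v" using orb_sym_subset[OF t(1) sv] t(3) by simp
  then have "s ` t ` orb \<Gamma> (s v) \<subseteq> s ` orb \<Gamma> v" by (rule image_mono)
  then show "orb \<Gamma> (s v) \<subseteq> s ` orb \<Gamma> v" by (simp add: image_image t(2))
qed (rule orb_sym_subset[OF s v])

lemma sym_image_orbs:
  assumes s: "s \<in> syms" and A: "A \<subseteq> K_vertices"
  shows "image s ` (orb \<Gamma> ` A) = orb \<Gamma> ` (s ` A)"
  unfolding image_image using orb_sym[OF s] A by (intro image_cong) auto

lemma syms_image_cells:
  assumes s: "s \<in> syms"
  shows "image s ` X_vertices \<Gamma> = X_vertices \<Gamma>"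
    and "(\<lambda>E. image s ` E) ` X_edges \<Gamma> = X_edges \<Gamma>"
    and "(\<lambda>F. image s ` F) ` X_faces \<Gamma> = X_faces \<Gamma>"
proof -
  obtain t where t: "t \<in> syms" "\<And>z. s (t z) = z" "\<And>z. t (s z) = z" using syms_inverse[OF s] by metis
  have V: "r ` K_vertices \<subseteq> K_vertices" and E: "\<And>A. A \<in> K_edges \<Longrightarrow> r ` A \<in> K_edges"
    and F: "\<And>A. A \<in> K_faces \<Longrightarrow> r ` A \<in> K_faces" if "r \<in> syms" for r
    using syms_cell_map[OF that] cell_map_vertex unfolding cell_map_def by blast+
  have st: "s ` t ` A = A" for A by (simp add: image_image t(2))
  have "s ` K_vertices = K_vertices" using V[OF s] image_mono[OF V[OF t(1)], of s] unfolding st by (rule equalityI)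
  then show "image s ` X_vertices \<Gamma> = X_vertices \<Gamma>"
    unfolding X_vertices_def sym_image_orbs[OF s order_refl] by simp
  have cells: "(\<lambda>A. image s ` A) ` ((\<lambda>A. orb \<Gamma> ` A) ` \<C>) = (\<lambda>A. orb \<Gamma> ` A) ` \<C>"
    if C: "\<And>A. A \<in> \<C> \<Longrightarrow> A \<subseteq> K_vertices" "\<And>r A. r \<in> syms \<Longrightarrow> A \<in> \<C> \<Longrightarrow> r ` A \<in> \<C>" for \<C>
  proof -
    have "image s ` \<C> = \<C>"
    proof
      show "image s ` \<C> \<subseteq> \<C>" using C(2)[OF s] by blast
      show "\<C> \<subseteq> image s ` \<C>"
      proof
        fix A assume "A \<in> \<C>"
        then show "A \<in> image s ` \<C>" using C(2)[OF t(1)] st[of A] by (metis imageI)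
      qed
    qed
    moreover have "(\<lambda>A. image s ` A) ` ((\<lambda>A. orb \<Gamma> ` A) ` \<C>) = (\<lambda>A. orb \<Gamma> ` A) ` (image s ` \<C>)"
      unfolding image_image[of "\<lambda>A. image s ` A"] image_image[of "\<lambda>A. orb \<Gamma> ` A"]
      using sym_image_orbs[OF s C(1)] by (intro image_cong) auto
    ultimately show ?thesis by simp
  qed
  show "(\<lambda>E. image s ` E) ` X_edges \<Gamma> = X_edges \<Gamma>"
    unfolding X_edges_def by (rule cells) (use edge_subset E in blast)+
  show "(\<lambda>F. image s ` F) ` X_faces \<Gamma> = X_faces \<Gamma>"
    unfolding X_faces_def by (rule cells) (use face_subset F in blast)+
qed

lemma syms_X_aut: "s \<in> syms \<Longrightarrow> image s \<in> X_aut \<Gamma>"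
proof -
  assume s: "s \<in> syms"
  then obtain t where "\<And>z. t (s z) = z" using syms_inverse[OF s] by metis
  then have "inj s" by (metis injI)
  then have "inj_on (image s) (X_vertices \<Gamma>)" by (metis inj_image_eq_iff inj_onI)
  then show ?thesis
    using syms_image_cells[OF s] unfolding X_aut_def bij_betw_def by simp
qed

lemma X_aut_comp: "\<sigma> \<in> X_aut \<Gamma> \<Longrightarrow> \<tau> \<in> X_aut \<Gamma> \<Longrightarrow> \<sigma> \<circ> \<tau> \<in> X_aut \<Gamma>"
proof -
  assume st: "\<sigma> \<in> X_aut \<Gamma>" "\<tau> \<in> X_aut \<Gamma>"
  have im: "(\<lambda>E. (\<sigma> \<circ> \<tau>) ` E) ` \<C> = (\<lambda>E. \<sigma> ` E) ` ((\<lambda>E. \<tau> ` E) ` \<C>)" for \<C>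
    by (simp only: image_comp[symmetric] image_image)
  have "bij_betw (\<sigma> \<circ> \<tau>) (X_vertices \<Gamma>) (X_vertices \<Gamma>)"
    by (rule bij_betw_trans[where B="X_vertices \<Gamma>"]) (use st in \<open>simp_all add: X_aut_def\<close>)
  then show ?thesis
    using st unfolding X_aut_def mem_Collect_eq im by simp
qed

text \<open>Precomposing with \<open>image s\<close> gives one inclusion; the other is the same
  inclusion for the inverse of s, which also lies in \<open>syms\<close>.\<close>

lemma vertex_orbit_sym:
  assumes s: "s \<in> syms" and v: "v \<in> K_vertices"
  shows "(\<lambda>\<sigma>. \<sigma> (orb \<Gamma> (s v))) ` X_aut \<Gamma> = (\<lambda>\<sigma>. \<sigma> (orb \<Gamma> v)) ` X_aut \<Gamma>"
proof -
  have sub: "(\<lambda>\<sigma>. \<sigma> (orb \<Gamma> (s v))) ` X_aut \<Gamma> \<subseteq> (\<lambda>\<sigma>. \<sigma> (orb \<Gamma> v)) ` X_aut \<Gamma>"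
    if "s \<in> syms" "v \<in> K_vertices" for s v
  proof
    fix y assume "y \<in> (\<lambda>\<sigma>. \<sigma> (orb \<Gamma> (s v))) ` X_aut \<Gamma>"
    then obtain \<sigma> where \<sigma>: "\<sigma> \<in> X_aut \<Gamma>" "y = \<sigma> (orb \<Gamma> (s v))" by blast
    have "y = (\<sigma> \<circ> image s) (orb \<Gamma> v)" using orb_sym[OF that] \<sigma>(2) by simp
    then show "y \<in> (\<lambda>\<sigma>. \<sigma> (orb \<Gamma> v)) ` X_aut \<Gamma>" using X_aut_comp[OF \<sigma>(1) syms_X_aut[OF that(1)]] by blast
  qed
  obtain t where t: "t \<in> syms" "\<And>z. t (s z) = z" using syms_inverse[OF s] by metis
  have sv: "s v \<in> K_vertices" using cell_map_vertex syms_cell_map s v by blast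
  show ?thesis by (rule equalityI[OF sub[OF s v] sub[OF t(1) sv, unfolded t(2)]])
qed

lemma orbit_bound: "finite (X_aut_vertex_orbits \<Gamma>) \<and> card (X_aut_vertex_orbits \<Gamma>) \<le> 6"
proof -
  \<comment> \<open>Since \<open>\<omega>^3 = -1\<close>, the half-turn identifies the exponents k
    and k - 3, so three rotations of the two representatives meet every class.\<close>
  define R where "R = (\<lambda>(k,u). \<omega>^k * u) ` ({0,1,2::nat} \<times> {W 1 0 0 0, W 1 0 1 (-1)})"
  define Orb where "Orb = (\<lambda>v. (\<lambda>\<sigma>. \<sigma> (orb \<Gamma> v)) ` X_aut \<Gamma>)"
  have finR: "finite R" unfolding R_def by simp
  have cardR: "card R \<le> 6"
  proof -
    have "card R \<le> card ({0,1,2::nat} \<times> {W 1 0 0 0, W 1 0 1 (-1)})" unfolding R_def by (rule card_image_le) simp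
    also have "\<dots> = 6" by (simp add: card_cartesian_product)
    finally show ?thesis .
  qed
  have RV: "R \<subseteq> K_vertices"
  proof -
    have "W 1 0 0 0 \<in> K_vertices" using hexagon_vertices(1) by (auto simp: hexagon_eq)
    moreover have "W 1 0 1 (-1) \<in> K_vertices" using face_subset[OF proto_face0[of 1]] by (simp add: protos_nth)
    ultimately have "\<omega>^k * u \<in> K_vertices" if "u \<in> {W 1 0 0 0, W 1 0 1 (-1)}" for k u
      using cell_map_vertex[OF cell_map_rot_power] that by blast
    moreover have "\<exists>k. \<exists>u\<in>{W 1 0 0 0, W 1 0 1 (-1)}. r = \<omega>^k * u" if "r \<in> R" for r
    proof -
      obtain x where x: "x \<in> {0,1,2::nat} \<times> {W 1 0 0 0, W 1 0 1 (-1)}" "r = (\<lambda>(k,u). \<omega>^k * u) x"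
        using \<open>r \<in> R\<close> unfolding R_def by blast
      have "snd x \<in> {W 1 0 0 0, W 1 0 1 (-1)}" "r = \<omega>^fst x * snd x"
        using x by (simp_all only: mem_Times_iff split_beta)
      then show ?thesis by blast
    qed
    ultimately show ?thesis by blast
  qed
  have "Orb v \<in> Orb ` R" if v: "v \<in> K_vertices" for v
  proof -
    obtain k u m n where k: "k < 6" "u \<in> {W 1 0 0 0, W 1 0 1 (-1)}" "v = \<omega>^k * u + lat m n"
      using vertex_form[OF v] unfolding vform_def by blast
    have "\<exists>r\<in>R. \<exists>c. (c = 1 \<or> c = -1) \<and> v = c * r + lat m n"
    proof (cases "k < 3")
      case True
      then have "k \<in> {0,1,2}" by auto
      then have "\<omega>^k * u \<in> R" unfolding R_def using k(2) by (intro rev_image_eqI[of "(k,u)"] SigmaI) simp_all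
      then show ?thesis using k(3) by (intro bexI[of _ "\<omega>^k * u"] exI[of _ 1]) simp_all
    next
      case False
      then have "k - 3 \<in> {0,1,2}" using k(1) by auto
      then have r: "\<omega>^(k-3) * u \<in> R" unfolding R_def using k(2) by (intro rev_image_eqI[of "(k-3,u)"] SigmaI) simp_all
      have "\<omega>^k = \<omega>^3 * \<omega>^(k-3)" using False by (simp flip: power_add)
      then have "v = -1 * (\<omega>^(k-3) * u) + lat m n" using k(3) by (simp add: omega_power3)
      then show ?thesis using r by blast
    qed
    then obtain r c where r: "r \<in> R" "c = 1 \<or> c = -1" "v = c * r + lat m n" by blast
    have s: "(\<lambda>z. c * z + lat m n) \<in> syms" unfolding syms_def using r(2) by blast
    have "Orb v = Orb r"
      unfolding Orb_def r(3) by (rule vertex_orbit_sym[OF s subsetD[OF RV r(1)]])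
    then show ?thesis using r(1) by blast
  qed
  then have "X_aut_vertex_orbits \<Gamma> \<subseteq> Orb ` R"
    unfolding X_aut_vertex_orbits_def X_vertices_def Orb_def by blast
  moreover have "finite (Orb ` R)" "card (Orb ` R) \<le> 6"
    using finR cardR card_image_le[OF finR, of Orb] by auto
  ultimately show ?thesis by (meson card_mono finite_subset order_trans)
qed

end

theorem theorem1:
  fixes \<Gamma> :: "(complex \<Rightarrow> complex) set"
  assumes "K_aut_subgroup \<Gamma>"
      and "acts_freely \<Gamma>"
      and "quotient_is_torus \<Gamma>"
      and "X_polyhedral \<Gamma>"
  shows "finite (X_aut_vertex_orbits \<Gamma>) \<and> card (X_aut_vertex_orbits \<Gamma>) \<le> 6"
proof -
  interpret torus_group \<Gamma>
    using assms(1-3) by unfold_locales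
  show ?thesis by (rule orbit_bound)
qed

end
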